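(* Let $\lambda>1$ be an ordinal and let $\Omega=\langle \omega^{\omega^\lambda};\times,1,\omega,\omega+1,\omega^2+1\rangle$. For each atomic formula $E(x_1,\dots,x_p)$ of $\langle\mathbb{N};+,\times,0,1\rangle$ (i.e. a Diophantine equation), the relation $$\texttt{EQ}_E=\{((\omega+1)^{j_1},\dots,(\omega+1)^{j_p})\mid j_1,\dots,j_p\in\mathbb{N},\ \langle\mathbb{N};+,\times,0,1\rangle\models E(j_1,\dots,j_p)\}$$ is definable in $\Omega$ by a formula of the form $\exists u_1\cdots\exists u_m\,\forall v_1\cdots\forall v_6\,\varphi$ with $\varphi$ quantifier-free (for some $m$).
   Context: $\Omega$ is the structure with domain the ordinal $\omega^{\omega^\lambda}$, the ordinal multiplication $\times$ and the constants $1,\omega,\omega+1,\omega^2+1$. *)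

theory Defs
  imports Main
begin

section \<open>Ordinals\<close>

text \<open>
  The type \<open>'a ordinal\<close> consists of the ordinals below the successor cardinal of
  \<open>|'a + nat|\<close>, with their natural well-ordering. It contains the order type of every
  well-order on \<open>'a\<close> (lemma \<open>ordinal_of_Well_order\<close>) and is closed under suprema of families
  indexed by a proper initial segment (lemma \<open>ordinal_bounded\<close>), hence under the arithmetic
  operations. A statement for a variable of type \<open>'a ordinal\<close> with \<open>'a\<close> an arbitrary type
  therefore speaks about all ordinals.
\<close>

abbreviation ordinal_rel :: "('a + nat) set rel" where
  "ordinal_rel \<equiv> cardSuc (card_of (UNIV :: ('a + nat) set))"

lemma Card_order_ordinal_rel: "Card_order (ordinal_rel :: ('a + nat) set rel)"
  by (rule cardSuc_Card_order) (rule card_of_Card_order)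

lemma Well_order_ordinal_rel: "Well_order (ordinal_rel :: ('a + nat) set rel)"
  using Card_order_ordinal_rel unfolding card_order_on_def by blast

lemma infinite_Field_ordinal_rel: "infinite (Field (ordinal_rel :: ('a + nat) set rel))"
  using cardSuc_finite[OF card_of_Card_order, of "UNIV :: ('a + nat) set"]
  by (simp add: Field_card_of finite_Plus_UNIV_iff)

typedef 'a ordinal = "Field (ordinal_rel :: ('a + nat) set rel)"
  using infinite_Field_ordinal_rel infinite_imp_nonempty by blast

instantiation ordinal :: (type) wellorder
begin

definition less_eq_ordinal :: "'a ordinal \<Rightarrow> 'a ordinal \<Rightarrow> bool" where
  "\<alpha> \<le> \<beta> \<longleftrightarrow> (Rep_ordinal \<alpha>, Rep_ordinal \<beta>) \<in> ordinal_rel"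

definition less_ordinal :: "'a ordinal \<Rightarrow> 'a ordinal \<Rightarrow> bool" where
  "(\<alpha> :: 'a ordinal) < \<beta> \<longleftrightarrow> \<alpha> \<le> \<beta> \<and> \<alpha> \<noteq> \<beta>"

instance
proof
  note W = Well_order_ordinal_rel[where 'a='a, unfolded well_order_on_def linear_order_on_def
      partial_order_on_def preorder_on_def]
  fix x y z :: "'a ordinal"
  show refl: "x \<le> x"
    using W Rep_ordinal[of x] by (auto simp: less_eq_ordinal_def refl_on_def)
  show "x \<le> y \<Longrightarrow> y \<le> z \<Longrightarrow> x \<le> z"
    using W unfolding less_eq_ordinal_def trans_def by blast
  have anti: "x \<le> y \<Longrightarrow> y \<le> x \<Longrightarrow> x = y" for x y :: "'a ordinal"
    using W unfolding less_eq_ordinal_def antisym_def by (metis Rep_ordinal_inject)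
  show "x \<le> y \<Longrightarrow> y \<le> x \<Longrightarrow> x = y" by (rule anti)
  show "x < y \<longleftrightarrow> x \<le> y \<and> \<not> y \<le> x"
    using anti refl unfolding less_ordinal_def by blast
  show "x \<le> y \<or> y \<le> x"
    using W Rep_ordinal[of x] Rep_ordinal[of y] refl
    unfolding less_eq_ordinal_def total_on_def by metis
next
  fix P :: "'a ordinal \<Rightarrow> bool" and a
  assume step: "\<And>x. (\<And>y. y < x \<Longrightarrow> P y) \<Longrightarrow> P x"
  have wf: "wf (ordinal_rel - Id :: ('a + nat) set rel)"
    using Well_order_ordinal_rel unfolding well_order_on_def by blast
  have "wf (inv_image (ordinal_rel - Id) (Rep_ordinal :: 'a ordinal \<Rightarrow> _))"
    by (rule wf_inv_image[OF wf])
  then show "P a"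
  proof (induction a rule: wf_induct_rule)
    case (less x)
    show ?case
    proof (rule step)
      fix y assume "y < x"
      then have "(Rep_ordinal y, Rep_ordinal x) \<in> ordinal_rel - Id"
        unfolding less_ordinal_def less_eq_ordinal_def using Rep_ordinal_inject[of y x] by blast
      then show "P y" by (intro less) (simp only: in_inv_image)
    qed
  qed
qed

end

lemma ordinal_bounded:
  fixes f :: "'b \<Rightarrow> 'a ordinal"
  assumes "ordLeq3 (card_of I) (card_of (UNIV :: ('a + nat) set))"
  shows "\<exists>\<gamma>. \<forall>i\<in>I. f i < \<gamma>"
proof (rule ccontr)
  let ?W = "ordinal_rel :: ('a + nat) set rel"
  let ?U = "card_of (UNIV :: ('a + nat) set)"
  assume contra: "\<not> ?thesis"
  let ?g = "\<lambda>i. Rep_ordinal (f i)"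
  \<comment> \<open>no greatest element, so \<open>f ` I\<close> unbounded gives cofinality\<close>
  have nomax: "\<exists>\<beta>. \<alpha> < \<beta>" for \<alpha> :: "'a ordinal"
  proof -
    have "\<exists>b\<in>Field ?W. Rep_ordinal \<alpha> \<noteq> b \<and> (Rep_ordinal \<alpha>, b) \<in> ?W"
      using infinite_Card_order_limit[OF Card_order_ordinal_rel infinite_Field_ordinal_rel
          Rep_ordinal[of \<alpha>]] by blast
    then show ?thesis
      by (metis Abs_ordinal_inverse less_eq_ordinal_def less_ordinal_def)
  qed
  have "cofinal (?g ` I) ?W"
    unfolding cofinal_def
  proof
    fix a assume a: "a \<in> Field ?W"
    obtain \<beta> where \<beta>: "Abs_ordinal a < \<beta>" using nomax by blast
    obtain i where i: "i \<in> I" "\<not> f i < \<beta>" using contra by blast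
    then have "Abs_ordinal a < f i" using \<beta> by auto
    then show "\<exists>b\<in>?g ` I. a \<noteq> b \<and> (a, b) \<in> ?W"
      using i a unfolding less_ordinal_def less_eq_ordinal_def
      by (metis Abs_ordinal_inverse Rep_ordinal_inject image_eqI)
  qed
  moreover have "regularCard ?W"
    by (rule infinite_cardSuc_regularCard)
      (simp_all add: Field_card_of finite_Plus_UNIV_iff card_of_card_order_on)
  moreover have "?g ` I \<subseteq> Field ?W" using Rep_ordinal by blast
  ultimately have iso: "ordIso2 (card_of (?g ` I)) ?W"
    unfolding regularCard_def by blast
  have "ordLeq3 (card_of (?g ` I)) ?U"
    using card_of_image assms ordLeq_transitive by blast
  then have "ordLeq3 ?W ?U"
    using iso ordIso_ordLeq_trans ordIso_symmetric by blast
  moreover have "ordLess2 ?U ?W"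
    by (rule cardSuc_greater) (rule card_of_Card_order)
  ultimately show False
    using not_ordLess_ordLeq by blast
qed

lemma card_of_lessThan_ordinal:
  fixes \<beta> :: "'a ordinal"
  shows "ordLeq3 (card_of {..<\<beta>}) (card_of (UNIV :: ('a + nat) set))"
proof -
  let ?W = "ordinal_rel :: ('a + nat) set rel"
  have "ordLess2 (card_of (underS ?W (Rep_ordinal \<beta>))) ?W"
    by (rule card_of_underS[OF Card_order_ordinal_rel Rep_ordinal])
  then have "ordLeq3 (card_of (underS ?W (Rep_ordinal \<beta>))) (card_of (UNIV :: ('a + nat) set))"
    using cardSuc_ordLeq_ordLess[OF card_of_Card_order card_of_Card_order] by blast
  moreover have "ordLeq3 (card_of {..<\<beta>}) (card_of (underS ?W (Rep_ordinal \<beta>)))"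
    by (rule card_of_ordLeqI[where f = Rep_ordinal])
      (auto simp: inj_on_def Rep_ordinal_inject underS_def less_ordinal_def less_eq_ordinal_def)
  ultimately show ?thesis using ordLeq_transitive by blast
qed

lemma ordinal_bounded_lessThan:
  fixes f :: "'a ordinal \<Rightarrow> 'a ordinal"
  shows "\<exists>\<gamma>. \<forall>\<delta><\<beta>. f \<delta> < \<gamma>"
  using ordinal_bounded[OF card_of_lessThan_ordinal, of \<beta> f] by auto

lemma ordinal_of_Well_order:
  fixes r :: "'a rel"
  assumes r: "Well_order r"
  shows "\<exists>(\<alpha> :: 'a ordinal) f. bij_betw f (Field r) {..<\<alpha>} \<and>
           (\<forall>x\<in>Field r. \<forall>y\<in>Field r. (x, y) \<in> r \<longleftrightarrow> f x \<le> f y)"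
proof -
  let ?W = "ordinal_rel :: ('a + nat) set rel"
  let ?U = "card_of (UNIV :: ('a + nat) set)"
  have "\<not> ordLeq3 ?W r"
  proof
    assume "ordLeq3 ?W r"
    then have "ordLeq3 (card_of (Field ?W)) (card_of (Field r))"
      using card_of_mono2 by blast
    moreover have "ordLeq3 (card_of (Field r)) ?U"
      by (rule card_of_ordLeqI[where f = Inl]) auto
    ultimately have "ordLeq3 ?W ?U"
      using card_of_Field_ordIso[OF Card_order_ordinal_rel]
      by (meson ordIso_ordLeq_trans ordIso_symmetric ordLeq_transitive)
    moreover have "ordLess2 ?U ?W"
      by (rule cardSuc_greater) (rule card_of_Card_order)
    ultimately show False using not_ordLess_ordLeq by blast
  qed
  then have "ordLess2 r ?W"
    using r Well_order_ordinal_rel not_ordLeq_iff_ordLess by blast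
  then obtain a where a: "a \<in> Field ?W" and iso: "ordIso2 r (Restr ?W (underS ?W a))"
    using ordLess_iff_ordIso_Restr[OF Well_order_ordinal_rel r] by blast
  have F: "Field (Restr ?W (underS ?W a)) = underS ?W a"
    using Field_Restr_ofilter[OF Well_order_ordinal_rel wo_rel.underS_ofilter]
      Well_order_ordinal_rel unfolding wo_rel_def by blast
  obtain g where g: "iso r (Restr ?W (underS ?W a)) g"
    using iso unfolding ordIso_def by blast
  have bij: "bij_betw g (Field r) (underS ?W a)"
    using g F unfolding iso_def by simp
  have ord: "(x, y) \<in> r \<longleftrightarrow> (g x, g y) \<in> ?W" if "x \<in> Field r" "y \<in> Field r" for x y
  proof -
    have "g x \<in> underS ?W a" "g y \<in> underS ?W a"
      using bij that unfolding bij_betw_def by blast+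
    moreover have "(x, y) \<in> r \<longleftrightarrow> (g x, g y) \<in> Restr ?W (underS ?W a)"
      using g that unfolding iso_iff2 by blast
    ultimately show ?thesis by blast
  qed
  let ?f = "\<lambda>x. Abs_ordinal (g x) :: 'a ordinal"
  have gF: "g x \<in> Field ?W" if "x \<in> Field r" for x
  proof -
    have "g x \<in> underS ?W a" using bij that unfolding bij_betw_def by blast
    then have "(g x, a) \<in> ?W" unfolding underS_def by blast
    then show ?thesis by (rule FieldI1)
  qed
  have 1: "bij_betw ?f (Field r) {..<Abs_ordinal a}"
    unfolding bij_betw_def
  proof
    show "inj_on ?f (Field r)"
    proof (rule inj_onI)
      fix x y assume xy: "x \<in> Field r" "y \<in> Field r" and "?f x = ?f y"
      then have "g x = g y" using Abs_ordinal_inject[OF gF gF] by blast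
      then show "x = y" using bij xy unfolding bij_betw_def by (meson inj_onD)
    qed
    show "?f ` Field r = {..<Abs_ordinal a}"
    proof (intro equalityI subsetI)
      fix z assume "z \<in> ?f ` Field r"
      then obtain x where x: "x \<in> Field r" and z: "z = ?f x" by blast
      have "g x \<in> underS ?W a" using bij x unfolding bij_betw_def by blast
      then have "(g x, a) \<in> ?W" "g x \<noteq> a" unfolding underS_def by blast+
      then show "z \<in> {..<Abs_ordinal a}"
        unfolding z lessThan_iff less_ordinal_def less_eq_ordinal_def
        by (simp add: Abs_ordinal_inverse[OF a] Abs_ordinal_inverse[OF gF[OF x]]
            Abs_ordinal_inject[OF gF[OF x] a])
    next
      fix z :: "'a ordinal" assume "z \<in> {..<Abs_ordinal a}"
      then have "(Rep_ordinal z, a) \<in> ?W" "Rep_ordinal z \<noteq> a"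
        using Abs_ordinal_inverse[OF a] Rep_ordinal_inverse[of z]
        by (auto simp: less_ordinal_def less_eq_ordinal_def)
      then have "Rep_ordinal z \<in> underS ?W a" unfolding underS_def by blast
      then obtain x where "x \<in> Field r" "Rep_ordinal z = g x"
        using bij unfolding bij_betw_def by blast
      then show "z \<in> ?f ` Field r" by (metis Rep_ordinal_inverse image_eqI)
    qed
  qed
  have 2: "\<forall>x\<in>Field r. \<forall>y\<in>Field r. (x, y) \<in> r \<longleftrightarrow> ?f x \<le> ?f y"
  proof (intro ballI)
    fix x y assume "x \<in> Field r" "y \<in> Field r"
    then show "(x, y) \<in> r \<longleftrightarrow> ?f x \<le> ?f y"
      unfolding less_eq_ordinal_def
      by (simp only: ord Abs_ordinal_inverse[OF gF])
  qed
  show ?thesis by (intro exI conjI) (rule 1, rule 2)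
qed


section \<open>Ordinal arithmetic\<close>

instantiation ordinal :: (type) "{zero, one, plus, times}"
begin

definition zero_ordinal :: "'a ordinal" where
  "0 = (LEAST \<gamma> :: 'a ordinal. True)"

definition one_ordinal :: "'a ordinal" where
  "1 = (LEAST \<gamma> :: 'a ordinal. 0 < \<gamma>)"

text \<open>
  Each operation is the usual transfinite recursion on the second argument, with the successor
  and limit clauses merged into one least upper bound; the separate clauses are derived below.
\<close>

function plus_ordinal :: "'a ordinal \<Rightarrow> 'a ordinal \<Rightarrow> 'a ordinal" where
  "plus_ordinal \<alpha> \<beta> = (LEAST \<gamma>. \<alpha> \<le> \<gamma> \<and> (\<forall>\<delta>\<in>{..<\<beta>}. plus_ordinal \<alpha> \<delta> < \<gamma>))"
  by pat_completeness auto
termination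
  by (relation "inv_image {(x, y). x < y} snd") (simp_all add: wf)

declare plus_ordinal.simps [simp del]

function times_ordinal :: "'a ordinal \<Rightarrow> 'a ordinal \<Rightarrow> 'a ordinal" where
  "times_ordinal \<alpha> \<beta> = (LEAST \<gamma>. \<forall>\<delta>\<in>{..<\<beta>}. times_ordinal \<alpha> \<delta> + \<alpha> \<le> \<gamma>)"
  by pat_completeness auto
termination
  by (relation "inv_image {(x, y). x < y} snd") (simp_all add: wf)

instance ..

end

declare times_ordinal.simps [simp del]

function ord_exp :: "'a ordinal \<Rightarrow> 'a ordinal \<Rightarrow> 'a ordinal" where
  "ord_exp \<alpha> \<beta> =
     (if \<beta> = 0 then 1 else (LEAST \<gamma>. \<forall>\<delta>\<in>{..<\<beta>}. ord_exp \<alpha> \<delta> * \<alpha> \<le> \<gamma>))"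
  by pat_completeness auto
termination
  by (relation "inv_image {(x, y). x < y} snd") (simp_all add: wf)

declare ord_exp.simps [simp del]

definition limit_ordinal :: "'a ordinal \<Rightarrow> bool" where
  "limit_ordinal \<beta> \<longleftrightarrow> \<beta> \<noteq> 0 \<and> (\<forall>\<delta><\<beta>. \<delta> + 1 < \<beta>)"

definition ord_omega :: "'a ordinal" where
  "ord_omega = (LEAST \<beta>. limit_ordinal \<beta>)"

lemma zero_le_ordinal [simp]: "(0 :: 'a ordinal) \<le> \<alpha>"
  unfolding zero_ordinal_def by (simp add: Least_le)

lemma not_less_zero_ordinal [simp]: "\<not> \<alpha> < (0 :: 'a ordinal)"
  by (simp add: not_less)

lemma less_plus_ordinal_iff:
  fixes \<alpha> :: "'a ordinal"
  shows "x < \<alpha> + \<beta> \<longleftrightarrow> x < \<alpha> \<or> (\<exists>\<delta><\<beta>. x \<le> \<alpha> + \<delta>)"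
proof -
  let ?P = "\<lambda>\<gamma>. \<alpha> \<le> \<gamma> \<and> (\<forall>\<delta>\<in>{..<\<beta>}. \<alpha> + \<delta> < \<gamma>)"
  obtain \<gamma> where \<gamma>: "\<forall>\<delta><\<beta>. \<alpha> + \<delta> < \<gamma>"
    using ordinal_bounded_lessThan[of \<beta> "\<lambda>\<delta>. \<alpha> + \<delta>"] by blast
  have "\<forall>\<delta><\<beta>. \<alpha> + \<delta> < max \<alpha> \<gamma>"
    using \<gamma> by (simp add: less_max_iff_disj)
  then have "?P (max \<alpha> \<gamma>)" by auto
  then have P: "?P (Least ?P)" by (rule LeastI)
  have eq: "\<alpha> + \<beta> = Least ?P" by (rule plus_ordinal.simps)
  show ?thesis
  proof
    assume "x < \<alpha> + \<beta>"
    then have "\<not> ?P x" using eq not_less_Least[of x ?P] by simp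
    then show "x < \<alpha> \<or> (\<exists>\<delta><\<beta>. x \<le> \<alpha> + \<delta>)" by auto
  next
    assume "x < \<alpha> \<or> (\<exists>\<delta><\<beta>. x \<le> \<alpha> + \<delta>)"
    moreover have "?P (\<alpha> + \<beta>)" using P unfolding eq .
    ultimately show "x < \<alpha> + \<beta>" by (meson le_less_trans lessThan_iff less_le_trans)
  qed
qed

lemma less_times_ordinal_iff:
  fixes \<alpha> :: "'a ordinal"
  shows "x < \<alpha> * \<beta> \<longleftrightarrow> (\<exists>\<delta><\<beta>. x < \<alpha> * \<delta> + \<alpha>)"
proof -
  let ?P = "\<lambda>\<gamma>. \<forall>\<delta>\<in>{..<\<beta>}. \<alpha> * \<delta> + \<alpha> \<le> \<gamma>"
  obtain \<gamma> where "\<forall>\<delta><\<beta>. \<alpha> * \<delta> + \<alpha> < \<gamma>"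
    using ordinal_bounded_lessThan[of \<beta> "\<lambda>\<delta>. \<alpha> * \<delta> + \<alpha>"] by blast
  then have "?P \<gamma>" by (auto intro: less_imp_le)
  then have P: "?P (Least ?P)" by (rule LeastI)
  have eq: "\<alpha> * \<beta> = Least ?P" by (rule times_ordinal.simps)
  show ?thesis
  proof
    assume "x < \<alpha> * \<beta>"
    then have "\<not> ?P x" using eq not_less_Least[of x ?P] by simp
    then show "\<exists>\<delta><\<beta>. x < \<alpha> * \<delta> + \<alpha>" by auto
  next
    assume "\<exists>\<delta><\<beta>. x < \<alpha> * \<delta> + \<alpha>"
    then show "x < \<alpha> * \<beta>" using P eq by (auto intro: less_le_trans)
  qed
qed

lemma less_ord_exp_iff:
  fixes \<alpha> :: "'a ordinal"
  assumes "\<beta> \<noteq> 0"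
  shows "x < ord_exp \<alpha> \<beta> \<longleftrightarrow> (\<exists>\<delta><\<beta>. x < ord_exp \<alpha> \<delta> * \<alpha>)"
proof -
  let ?P = "\<lambda>\<gamma>. \<forall>\<delta>\<in>{..<\<beta>}. ord_exp \<alpha> \<delta> * \<alpha> \<le> \<gamma>"
  obtain \<gamma> where "\<forall>\<delta><\<beta>. ord_exp \<alpha> \<delta> * \<alpha> < \<gamma>"
    using ordinal_bounded_lessThan[of \<beta> "\<lambda>\<delta>. ord_exp \<alpha> \<delta> * \<alpha>"] by blast
  then have "?P \<gamma>" by (auto intro: less_imp_le)
  then have P: "?P (Least ?P)" by (rule LeastI)
  have eq: "ord_exp \<alpha> \<beta> = Least ?P" using assms by (simp add: ord_exp.simps[of \<alpha> \<beta>])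
  show ?thesis
  proof
    assume "x < ord_exp \<alpha> \<beta>"
    then have "\<not> ?P x" using eq not_less_Least[of x ?P] by simp
    then show "\<exists>\<delta><\<beta>. x < ord_exp \<alpha> \<delta> * \<alpha>" by auto
  next
    assume "\<exists>\<delta><\<beta>. x < ord_exp \<alpha> \<delta> * \<alpha>"
    then show "x < ord_exp \<alpha> \<beta>" using P eq by (auto intro: less_le_trans)
  qed
qed

lemma ordinal_eqI:
  fixes \<alpha> :: "'a ordinal"
  assumes "\<And>x. x < \<alpha> \<longleftrightarrow> x < \<beta>"
  shows "\<alpha> = \<beta>"
  using assms by (metis less_irrefl linorder_neqE)

lemma zero_less_one_ordinal [simp]: "(0 :: 'a ordinal) < 1"
proof -
  obtain \<gamma> :: "'a ordinal" where "\<forall>i\<in>{()}. 0 < \<gamma>"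
    using ordinal_bounded[of "{()}" "\<lambda>_. 0 :: 'a ordinal"]
    by (metis UNIV_I card_of_singl_ordLeq empty_iff ordLeq_transitive)
  then show ?thesis unfolding one_ordinal_def by (auto intro: LeastI)
qed

lemma less_one_ordinal_iff [simp]: "\<alpha> < (1 :: 'a ordinal) \<longleftrightarrow> \<alpha> = 0"
proof
  show "\<alpha> < 1 \<Longrightarrow> \<alpha> = 0"
    unfolding one_ordinal_def using not_less_Least zero_le_ordinal by (metis order_le_less)
qed simp

lemma ordinal_add_zero: "\<alpha> + 0 = (\<alpha> :: 'a ordinal)"
  by (rule ordinal_eqI) (simp add: less_plus_ordinal_iff)

lemma less_add_one_ordinal_iff: "x < \<alpha> + 1 \<longleftrightarrow> x \<le> (\<alpha> :: 'a ordinal)"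
  by (auto simp: less_plus_ordinal_iff ordinal_add_zero)

lemma ordinal_add_strict_mono: "\<beta> < \<gamma> \<Longrightarrow> \<alpha> + \<beta> < \<alpha> + (\<gamma> :: 'a ordinal)"
  using less_plus_ordinal_iff by blast

lemma ordinal_add_mono: "\<beta> \<le> \<gamma> \<Longrightarrow> \<alpha> + \<beta> \<le> \<alpha> + (\<gamma> :: 'a ordinal)"
  using ordinal_add_strict_mono by (metis order_le_less)

lemma ordinal_le_add: "\<alpha> \<le> \<alpha> + (\<beta> :: 'a ordinal)"
  using ordinal_add_mono[of 0 \<beta> \<alpha>] by (simp add: ordinal_add_zero)

lemma ordinal_add_assoc: "\<alpha> + \<beta> + \<gamma> = \<alpha> + (\<beta> + \<gamma> :: 'a ordinal)"
proof (induction \<gamma> rule: less_induct)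
  case (less \<gamma>)
  show ?case
  proof (rule ordinal_eqI)
    fix x
    have "x < \<alpha> + (\<beta> + \<gamma>) \<longleftrightarrow> x < \<alpha> \<or> (\<exists>\<delta><\<beta>. x \<le> \<alpha> + \<delta>) \<or> (\<exists>\<delta><\<gamma>. x \<le> \<alpha> + (\<beta> + \<delta>))"
    proof
      assume "x < \<alpha> + (\<beta> + \<gamma>)"
      then consider "x < \<alpha>" | \<delta> where "\<delta> < \<beta> + \<gamma>" "x \<le> \<alpha> + \<delta>"
        unfolding less_plus_ordinal_iff[of x \<alpha> "\<beta> + \<gamma>"] by blast
      then show "x < \<alpha> \<or> (\<exists>\<delta><\<beta>. x \<le> \<alpha> + \<delta>) \<or> (\<exists>\<delta><\<gamma>. x \<le> \<alpha> + (\<beta> + \<delta>))"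
      proof cases
        case 2
        then show ?thesis
          using less_plus_ordinal_iff[of \<delta> \<beta> \<gamma>] ordinal_add_mono[of \<delta> _ \<alpha>] order_trans by blast
      qed blast
    next
      assume "x < \<alpha> \<or> (\<exists>\<delta><\<beta>. x \<le> \<alpha> + \<delta>) \<or> (\<exists>\<delta><\<gamma>. x \<le> \<alpha> + (\<beta> + \<delta>))"
      then show "x < \<alpha> + (\<beta> + \<gamma>)"
        unfolding less_plus_ordinal_iff[of x \<alpha> "\<beta> + \<gamma>"]
        using less_plus_ordinal_iff[of _ \<beta> \<gamma>] by blast
    qed
    moreover have "x < \<alpha> + \<beta> + \<gamma> \<longleftrightarrow> x < \<alpha> + \<beta> \<or> (\<exists>\<delta><\<gamma>. x \<le> \<alpha> + (\<beta> + \<delta>))"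
      using less.IH by (auto simp: less_plus_ordinal_iff[of x "\<alpha> + \<beta>" \<gamma>])
    ultimately show "x < \<alpha> + \<beta> + \<gamma> \<longleftrightarrow> x < \<alpha> + (\<beta> + \<gamma>)"
      using less_plus_ordinal_iff[of x \<alpha> \<beta>] by blast
  qed
qed

lemma ordinal_add_succ: "\<alpha> + (\<beta> + 1) = (\<alpha> + \<beta>) + (1 :: 'a ordinal)"
  by (simp add: ordinal_add_assoc)

lemma ordinal_add_limit:
  assumes "limit_ordinal \<beta>"
  shows "\<alpha> + \<beta> = (LEAST \<gamma>. \<forall>\<delta><\<beta>. \<alpha> + \<delta> \<le> \<gamma>)"
proof (rule Least_equality[symmetric])
  show "\<forall>\<delta><\<beta>. \<alpha> + \<delta> \<le> \<alpha> + \<beta>" using ordinal_add_mono less_imp_le by blast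
next
  fix y assume y: "\<forall>\<delta><\<beta>. \<alpha> + \<delta> \<le> y"
  show "\<alpha> + \<beta> \<le> y"
  proof (rule ccontr)
    assume "\<not> \<alpha> + \<beta> \<le> y"
    then have "y < \<alpha> + \<beta>" by simp
    moreover have "0 < \<beta>" using assms unfolding limit_ordinal_def by (simp add: order_less_le)
    moreover have "\<alpha> \<le> y" using y \<open>0 < \<beta>\<close> by (metis ordinal_add_zero)
    ultimately obtain \<delta> where \<delta>: "\<delta> < \<beta>" "y \<le> \<alpha> + \<delta>"
      using less_plus_ordinal_iff[of y \<alpha> \<beta>] by auto
    then have "\<delta> + 1 < \<beta>" using assms unfolding limit_ordinal_def by blast
    then have "\<alpha> + (\<delta> + 1) \<le> y" using y by blast
    then show False
      using \<delta> ordinal_add_strict_mono[of \<delta> "\<delta> + 1" \<alpha>] less_add_one_ordinal_iff[of \<delta> \<delta>] by simp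
  qed
qed

lemma ordinal_times_zero: "\<alpha> * 0 = (0 :: 'a ordinal)"
  by (rule ordinal_eqI) (simp add: less_times_ordinal_iff)

lemma ordinal_times_mono: "\<beta> \<le> \<gamma> \<Longrightarrow> \<alpha> * \<beta> \<le> \<alpha> * (\<gamma> :: 'a ordinal)"
  using less_times_ordinal_iff by (metis leD leI less_le_trans order_refl)

lemma ordinal_zero_add: "0 + \<alpha> = (\<alpha> :: 'a ordinal)"
proof (induction \<alpha> rule: less_induct)
  case (less \<alpha>)
  then show ?case
    by (intro ordinal_eqI) (auto simp: less_plus_ordinal_iff intro: le_less_trans)
qed

lemma ordinal_add_right_mono: "\<alpha> \<le> \<beta> \<Longrightarrow> \<alpha> + \<gamma> \<le> \<beta> + (\<gamma> :: 'a ordinal)"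
proof (induction \<gamma> rule: less_induct)
  case (less \<gamma>)
  show ?case
  proof (rule ccontr)
    assume "\<not> ?case"
    then have "\<beta> + \<gamma> < \<alpha> + \<gamma>" by simp
    then consider "\<beta> + \<gamma> < \<alpha>" | \<delta> where "\<delta> < \<gamma>" "\<beta> + \<gamma> \<le> \<alpha> + \<delta>"
      using less_plus_ordinal_iff[of "\<beta> + \<gamma>" \<alpha> \<gamma>] by blast
    then show False
    proof cases
      case 1
      then show ?thesis using less.prems ordinal_le_add[of \<beta> \<gamma>] by simp
    next
      case 2
      then have "\<beta> + \<gamma> \<le> \<beta> + \<delta>" using less by (meson order_trans)
      then show ?thesis using ordinal_add_strict_mono[OF 2(1), of \<beta>] by simp
    qed
  qed
qed

lemma ordinal_times_succ: "\<alpha> * (\<beta> + 1) = \<alpha> * \<beta> + (\<alpha> :: 'a ordinal)"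
proof (rule ordinal_eqI)
  fix x
  show "x < \<alpha> * (\<beta> + 1) \<longleftrightarrow> x < \<alpha> * \<beta> + \<alpha>"
    unfolding less_times_ordinal_iff[of x \<alpha> "\<beta> + 1"] less_add_one_ordinal_iff
    using ordinal_add_right_mono[OF ordinal_times_mono] by (meson less_le_trans order_refl)
qed

lemma ordinal_times_limit:
  assumes "limit_ordinal \<beta>"
  shows "\<alpha> * \<beta> = (LEAST \<gamma>. \<forall>\<delta><\<beta>. \<alpha> * \<delta> \<le> \<gamma>)"
proof (rule Least_equality[symmetric])
  show "\<forall>\<delta><\<beta>. \<alpha> * \<delta> \<le> \<alpha> * \<beta>" using ordinal_times_mono less_imp_le by blast
next
  fix y assume y: "\<forall>\<delta><\<beta>. \<alpha> * \<delta> \<le> y"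
  show "\<alpha> * \<beta> \<le> y"
  proof (rule ccontr)
    assume "\<not> \<alpha> * \<beta> \<le> y"
    then obtain \<delta> where \<delta>: "\<delta> < \<beta>" "y < \<alpha> * \<delta> + \<alpha>"
      using less_times_ordinal_iff[of y \<alpha> \<beta>] by auto
    then have "\<delta> + 1 < \<beta>" using assms unfolding limit_ordinal_def by blast
    then show False using y \<delta> ordinal_times_succ by (metis leD)
  qed
qed

lemma ordinal_times_one: "\<alpha> * 1 = (\<alpha> :: 'a ordinal)"
  using ordinal_times_succ[of \<alpha> 0] by (simp add: ordinal_zero_add ordinal_times_zero)

lemma ordinal_one_times: "1 * \<alpha> = (\<alpha> :: 'a ordinal)"
proof (induction \<alpha> rule: less_induct)
  case (less \<alpha>)
  then show ?case
    by (intro ordinal_eqI)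
      (auto simp: less_times_ordinal_iff less_add_one_ordinal_iff intro: le_less_trans)
qed

lemma ordinal_distrib_left: "\<alpha> * (\<beta> + \<gamma>) = \<alpha> * \<beta> + \<alpha> * (\<gamma> :: 'a ordinal)"
proof (induction \<gamma> rule: less_induct)
  case (less \<gamma>)
  show ?case
  proof (cases "\<gamma> = 0")
    case True
    then show ?thesis by (simp add: ordinal_add_zero ordinal_times_zero)
  next
    case False
    then have pos: "0 < \<gamma>" by (simp add: order_less_le)
    show ?thesis
    proof (rule ordinal_eqI)
      fix x
      show "x < \<alpha> * (\<beta> + \<gamma>) \<longleftrightarrow> x < \<alpha> * \<beta> + \<alpha> * \<gamma>"
      proof
        assume "x < \<alpha> * (\<beta> + \<gamma>)"
        then obtain \<epsilon> where \<epsilon>: "\<epsilon> < \<beta> + \<gamma>" "x < \<alpha> * \<epsilon> + \<alpha>"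
          using less_times_ordinal_iff by blast
        obtain \<delta> where \<delta>: "\<delta> < \<gamma>" "\<epsilon> \<le> \<beta> + \<delta>"
          using \<epsilon>(1) pos unfolding less_plus_ordinal_iff[of \<epsilon> \<beta> \<gamma>]
          by (metis less_imp_le ordinal_add_zero)
        have "x < \<alpha> * (\<beta> + \<delta>) + \<alpha>"
          using \<epsilon>(2) ordinal_add_right_mono[OF ordinal_times_mono[OF \<delta>(2)]] less_le_trans by blast
        also have "\<dots> = \<alpha> * \<beta> + \<alpha> * (\<delta> + 1)"
          using less.IH[OF \<delta>(1)] by (simp add: ordinal_times_succ ordinal_add_assoc)
        also have "\<dots> \<le> \<alpha> * \<beta> + \<alpha> * \<gamma>"
          using \<delta>(1) by (intro ordinal_add_mono ordinal_times_mono)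
            (metis less_add_one_ordinal_iff not_le)
        finally show "x < \<alpha> * \<beta> + \<alpha> * \<gamma>" .
      next
        assume "x < \<alpha> * \<beta> + \<alpha> * \<gamma>"
        then consider "x < \<alpha> * \<beta>" | \<epsilon> where "\<epsilon> < \<alpha> * \<gamma>" "x \<le> \<alpha> * \<beta> + \<epsilon>"
          using less_plus_ordinal_iff by blast
        then show "x < \<alpha> * (\<beta> + \<gamma>)"
        proof cases
          case 1
          then show ?thesis
            using ordinal_times_mono[OF ordinal_le_add] less_le_trans by blast
        next
          case 2
          then obtain \<delta> where \<delta>: "\<delta> < \<gamma>" "\<epsilon> < \<alpha> * \<delta> + \<alpha>"
            using less_times_ordinal_iff by blast
          have "x < \<alpha> * \<beta> + (\<alpha> * \<delta> + \<alpha>)"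
            using 2(2) ordinal_add_strict_mono[OF \<delta>(2)] le_less_trans by blast
          also have "\<dots> = \<alpha> * (\<beta> + \<delta>) + \<alpha>"
            using less.IH[OF \<delta>(1)] by (simp add: ordinal_add_assoc)
          finally show ?thesis
            using ordinal_add_strict_mono[OF \<delta>(1), of \<beta>] less_times_ordinal_iff by blast
        qed
      qed
    qed
  qed
qed

lemma ordinal_times_assoc: "\<alpha> * \<beta> * \<gamma> = \<alpha> * (\<beta> * \<gamma> :: 'a ordinal)"
proof (induction \<gamma> rule: less_induct)
  case (less \<gamma>)
  have step: "\<alpha> * \<beta> * \<delta> + \<alpha> * \<beta> = \<alpha> * (\<beta> * \<delta> + \<beta>)" if "\<delta> < \<gamma>" for \<delta>
    using less[OF that] by (simp add: ordinal_distrib_left)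
  show ?case
  proof (rule ordinal_eqI)
    fix x
    have "x < \<alpha> * (\<beta> * \<gamma>) \<longleftrightarrow> (\<exists>\<delta><\<gamma>. x < \<alpha> * (\<beta> * \<delta> + \<beta>))"
      unfolding less_times_ordinal_iff[of x \<alpha>] less_times_ordinal_iff[of _ \<beta> \<gamma>] by blast
    then show "x < \<alpha> * \<beta> * \<gamma> \<longleftrightarrow> x < \<alpha> * (\<beta> * \<gamma>)"
      unfolding less_times_ordinal_iff[of x "\<alpha> * \<beta>" \<gamma>] using step by auto
  qed
qed

instance ordinal :: (type) monoid_add
  by standard (rule ordinal_add_assoc ordinal_zero_add ordinal_add_zero)+

instance ordinal :: (type) monoid_mult
  by standard (rule ordinal_times_assoc ordinal_one_times ordinal_times_one)+

lemma ordinal_times_right_mono: "\<alpha> \<le> \<beta> \<Longrightarrow> \<alpha> * \<gamma> \<le> \<beta> * (\<gamma> :: 'a ordinal)"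
proof (induction \<gamma> rule: less_induct)
  case (less \<gamma>)
  have "x < \<beta> * \<gamma>" if x: "x < \<alpha> * \<gamma>" for x
  proof -
    obtain \<delta> where \<delta>: "\<delta> < \<gamma>" "x < \<alpha> * \<delta> + \<alpha>"
      using x less_times_ordinal_iff by blast
    have "\<alpha> * \<delta> + \<alpha> \<le> \<beta> * \<delta> + \<beta>"
      using ordinal_add_right_mono[OF less.IH[OF \<delta>(1) less.prems], of \<alpha>]
        ordinal_add_mono[OF less.prems, of "\<beta> * \<delta>"] by (rule order_trans)
    then show ?thesis using \<delta> less_times_ordinal_iff less_le_trans by blast
  qed
  then show ?case by (meson leI less_irrefl)
qed

lemma ord_exp_zero: "ord_exp \<alpha> 0 = 1"
  by (simp add: ord_exp.simps)

lemma ord_exp_pos: "0 < \<alpha> \<Longrightarrow> 0 < ord_exp \<alpha> \<beta>"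
proof (cases "\<beta> = 0")
  case False
  assume "0 < \<alpha>"
  moreover have "0 < \<beta>" using False by (simp add: order_less_le)
  ultimately show ?thesis
    using less_ord_exp_iff[OF False, of 0 \<alpha>] by (metis mult_1_left ord_exp_zero)
qed (simp add: ord_exp_zero)

lemma ord_exp_mono:
  assumes "0 < \<alpha>" "\<beta> \<le> \<gamma>"
  shows "ord_exp \<alpha> \<beta> \<le> ord_exp \<alpha> \<gamma>"
proof (cases "\<beta> = 0")
  case True
  then show ?thesis
    using ord_exp_pos[OF assms(1), of \<gamma>] by (metis leI less_one_ordinal_iff order_less_irrefl ord_exp_zero)
next
  case False
  then have "\<gamma> \<noteq> 0" using assms(2) by (metis not_less_zero_ordinal order_le_less)
  then have "x < ord_exp \<alpha> \<gamma>" if "x < ord_exp \<alpha> \<beta>" for x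
    using that False assms(2) less_ord_exp_iff less_le_trans by metis
  then show ?thesis by (meson leI less_irrefl)
qed

lemma ord_exp_succ:
  assumes "0 < \<alpha>"
  shows "ord_exp \<alpha> (\<beta> + 1) = ord_exp \<alpha> \<beta> * \<alpha>"
proof (rule ordinal_eqI)
  fix x
  have "\<beta> + 1 \<noteq> 0" using less_add_one_ordinal_iff[of \<beta> \<beta>] by auto
  then show "x < ord_exp \<alpha> (\<beta> + 1) \<longleftrightarrow> x < ord_exp \<alpha> \<beta> * \<alpha>"
    unfolding less_ord_exp_iff[OF \<open>\<beta> + 1 \<noteq> 0\<close>] less_add_one_ordinal_iff
    using ordinal_times_right_mono[OF ord_exp_mono[OF assms]] by (meson less_le_trans order_refl)
qed

lemma ord_exp_limit:
  assumes "0 < \<alpha>" "limit_ordinal \<beta>"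
  shows "ord_exp \<alpha> \<beta> = (LEAST \<gamma>. \<forall>\<delta><\<beta>. ord_exp \<alpha> \<delta> \<le> \<gamma>)"
proof (rule Least_equality[symmetric])
  show "\<forall>\<delta><\<beta>. ord_exp \<alpha> \<delta> \<le> ord_exp \<alpha> \<beta>"
    using ord_exp_mono[OF assms(1)] less_imp_le by blast
next
  fix y assume y: "\<forall>\<delta><\<beta>. ord_exp \<alpha> \<delta> \<le> y"
  show "ord_exp \<alpha> \<beta> \<le> y"
  proof (rule ccontr)
    assume "\<not> ord_exp \<alpha> \<beta> \<le> y"
    then obtain \<delta> where \<delta>: "\<delta> < \<beta>" "y < ord_exp \<alpha> \<delta> * \<alpha>"
      using less_ord_exp_iff[of \<beta> y \<alpha>] assms(2) unfolding limit_ordinal_def by auto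
    then have "\<delta> + 1 < \<beta>" using assms(2) unfolding limit_ordinal_def by blast
    then show False using y \<delta> ord_exp_succ[OF assms(1)] by (metis leD)
  qed
qed

lemma limit_ordinal_omega: "limit_ordinal (ord_omega :: 'a ordinal)"
proof -
  define f :: "nat \<Rightarrow> 'a ordinal" where "f = rec_nat 0 (\<lambda>_ \<alpha>. \<alpha> + 1)"
  have fS: "f (Suc n) = f n + 1" for n by (simp add: f_def)
  have "ordLeq3 (card_of (UNIV :: nat set)) (card_of (UNIV :: ('a + nat) set))"
    by (rule card_of_ordLeqI[where f = Inr]) auto
  then obtain \<gamma> where \<gamma>: "\<forall>n. f n < \<gamma>" using ordinal_bounded[of UNIV f] by auto
  define \<beta> where "\<beta> = (LEAST \<gamma>. \<forall>n. f n < \<gamma>)"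
  have \<beta>: "f n < \<beta>" for n
    using LeastI[of "\<lambda>\<gamma>. \<forall>n. f n < \<gamma>", OF \<gamma>] unfolding \<beta>_def by blast
  have "\<delta> + 1 < \<beta>" if \<delta>: "\<delta> < \<beta>" for \<delta>
  proof -
    obtain n where "\<delta> \<le> f n"
      using not_less_Least[OF \<delta>[unfolded \<beta>_def]] by (meson not_less)
    then have "\<delta> + 1 \<le> f (Suc n)" unfolding fS by (rule ordinal_add_right_mono)
    then show ?thesis using \<beta>[of "Suc n"] by (rule le_less_trans)
  qed
  moreover have "\<beta> \<noteq> 0" using \<beta>[of 0] by auto
  ultimately have "limit_ordinal \<beta>" unfolding limit_ordinal_def by blast
  then show ?thesis unfolding ord_omega_def by (rule LeastI)
qed


section \<open>First-order logic over constants and binary operations\<close>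

datatype ('c, 'b) trm =
    Var nat
  | Const 'c
  | Bin 'b "('c, 'b) trm" "('c, 'b) trm"

datatype ('c, 'b) fm =
    Eq "('c, 'b) trm" "('c, 'b) trm"
  | Neg "('c, 'b) fm"
  | Conj "('c, 'b) fm" "('c, 'b) fm"
  | Disj "('c, 'b) fm" "('c, 'b) fm"
  | Ex nat "('c, 'b) fm"
  | All nat "('c, 'b) fm"

record ('c, 'b, 'd) fo_structure =
  domain :: "'d set"
  const_of :: "'c \<Rightarrow> 'd"
  bin_of :: "'b \<Rightarrow> 'd \<Rightarrow> 'd \<Rightarrow> 'd"

primrec val :: "('c, 'b, 'd) fo_structure \<Rightarrow> (nat \<Rightarrow> 'd) \<Rightarrow> ('c, 'b) trm \<Rightarrow> 'd" where
  "val M e (Var i) = e i"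
| "val M e (Const c) = const_of M c"
| "val M e (Bin b s t) = bin_of M b (val M e s) (val M e t)"

primrec sat :: "('c, 'b, 'd) fo_structure \<Rightarrow> (nat \<Rightarrow> 'd) \<Rightarrow> ('c, 'b) fm \<Rightarrow> bool" where
  "sat M e (Eq s t) \<longleftrightarrow> val M e s = val M e t"
| "sat M e (Neg \<phi>) \<longleftrightarrow> \<not> sat M e \<phi>"
| "sat M e (Conj \<phi> \<psi>) \<longleftrightarrow> sat M e \<phi> \<and> sat M e \<psi>"
| "sat M e (Disj \<phi> \<psi>) \<longleftrightarrow> sat M e \<phi> \<or> sat M e \<psi>"
| "sat M e (Ex i \<phi>) \<longleftrightarrow> (\<exists>a\<in>domain M. sat M (e(i := a)) \<phi>)"
| "sat M e (All i \<phi>) \<longleftrightarrow> (\<forall>a\<in>domain M. sat M (e(i := a)) \<phi>)"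

primrec trm_vars :: "('c, 'b) trm \<Rightarrow> nat set" where
  "trm_vars (Var i) = {i}"
| "trm_vars (Const c) = {}"
| "trm_vars (Bin b s t) = trm_vars s \<union> trm_vars t"

primrec free_vars :: "('c, 'b) fm \<Rightarrow> nat set" where
  "free_vars (Eq s t) = trm_vars s \<union> trm_vars t"
| "free_vars (Neg \<phi>) = free_vars \<phi>"
| "free_vars (Conj \<phi> \<psi>) = free_vars \<phi> \<union> free_vars \<psi>"
| "free_vars (Disj \<phi> \<psi>) = free_vars \<phi> \<union> free_vars \<psi>"
| "free_vars (Ex i \<phi>) = free_vars \<phi> - {i}"
| "free_vars (All i \<phi>) = free_vars \<phi> - {i}"

primrec quantifier_free :: "('c, 'b) fm \<Rightarrow> bool" where
  "quantifier_free (Eq s t) \<longleftrightarrow> True"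
| "quantifier_free (Neg \<phi>) \<longleftrightarrow> quantifier_free \<phi>"
| "quantifier_free (Conj \<phi> \<psi>) \<longleftrightarrow> quantifier_free \<phi> \<and> quantifier_free \<psi>"
| "quantifier_free (Disj \<phi> \<psi>) \<longleftrightarrow> quantifier_free \<phi> \<and> quantifier_free \<psi>"
| "quantifier_free (Ex i \<phi>) \<longleftrightarrow> False"
| "quantifier_free (All i \<phi>) \<longleftrightarrow> False"

definition atomic_fm :: "('c, 'b) fm \<Rightarrow> bool" where
  "atomic_fm \<phi> \<longleftrightarrow> (\<exists>s t. \<phi> = Eq s t)"

definition exists_forall_form :: "nat \<Rightarrow> nat \<Rightarrow> ('c, 'b) fm \<Rightarrow> bool" where
  "exists_forall_form m k \<Phi> \<longleftrightarrow>
     (\<exists>us vs \<phi>. length us = m \<and> length vs = k \<and> distinct (us @ vs) \<and> quantifier_free \<phi> \<and>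
        \<Phi> = foldr Ex us (foldr All vs \<phi>))"

text \<open>
  The free variables \<open>x\<^sub>1, \<dots>, x\<^sub>p\<close> are \<open>Var 0, \<dots>, Var (p - 1)\<close>, and
  \<open>p\<close>-tuples are lists of length \<open>p\<close>. The value \<open>xs ! i\<close> for \<open>i \<ge> p\<close> is irrelevant because
  such variables do not occur free.
\<close>

definition defines_relation ::
  "('c, 'b, 'd) fo_structure \<Rightarrow> nat \<Rightarrow> ('c, 'b) fm \<Rightarrow> 'd list set \<Rightarrow> bool" where
  "defines_relation M p \<Phi> R \<longleftrightarrow>
     free_vars \<Phi> \<subseteq> {..<p} \<and>
     R = {xs. length xs = p \<and> set xs \<subseteq> domain M \<and> sat M ((!) xs) \<Phi>}"


section \<open>The two structures\<close>

datatype nat_const = NZero | NOne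
datatype nat_op = NPlus | NTimes

definition nat_structure :: "(nat_const, nat_op, nat) fo_structure" where
  "nat_structure =
     \<lparr>domain = UNIV,
      const_of = (\<lambda>c. case c of NZero \<Rightarrow> 0 | NOne \<Rightarrow> 1),
      bin_of = (\<lambda>b. case b of NPlus \<Rightarrow> (+) | NTimes \<Rightarrow> (*))\<rparr>"

datatype omega_const = C_one | C_omega | C_omega_plus_one | C_omega_sq_plus_one
datatype omega_op = O_times

definition omega_structure ::
  "'a ordinal \<Rightarrow> (omega_const, omega_op, 'a ordinal) fo_structure" where
  "omega_structure l =
     \<lparr>domain = {\<alpha>. \<alpha> < ord_exp ord_omega (ord_exp ord_omega l)},
      const_of = (\<lambda>c. case c of
          C_one \<Rightarrow> 1
        | C_omega \<Rightarrow> ord_omega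
        | C_omega_plus_one \<Rightarrow> ord_omega + 1
        | C_omega_sq_plus_one \<Rightarrow> ord_omega ^ 2 + 1),
      bin_of = (\<lambda>b. case b of O_times \<Rightarrow> (*))\<rparr>"

definition EQ_rel :: "nat \<Rightarrow> (nat_const, nat_op) fm \<Rightarrow> 'a ordinal list set" where
  "EQ_rel p E =
     {map (\<lambda>j. (ord_omega + 1) ^ j) js | js :: nat list.
        length js = p \<and> sat nat_structure ((!) js) E}"

end

theory Submission
  imports Defs
begin

text \<open>
  The number \<open>k\<close> is represented by \<open>\<omega>\<^sup>k\<close>; these ordinals are exactly the nonzero ones commuting with \<open>\<omega>\<close>,
  and multiplying them adds exponents. The ordinal \<open>(\<omega> + 1)\<^sup>k\<close> is the only \<open>\<xi>\<close> that commutes with \<open>\<omega> + 1\<close> and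
  satisfies \<open>\<xi> \<omega> = \<omega>\<^sup>k \<omega>\<close>, so it only remains to define multiplication of exponents.

  For \<open>n \<ge> 1\<close> the ordinal \<open>s = \<omega>\<^sup>n + 1\<close> is the only multiplicatively irreducible \<open>s \<noteq> \<omega>\<close> with
  \<open>s \<omega> = \<omega>\<^sup>n \<omega>\<close>, and \<open>n\<close> divides \<open>m\<close> iff some \<open>\<xi>\<close> with \<open>\<xi> \<omega> = \<omega>\<^sup>m \<omega>\<close> commutes with \<open>s\<close>, the
  witnesses being the powers of \<open>s\<close>. Hence \<open>n (n + 1)\<close>, the least positive common multiple of \<open>n\<close> and \<open>n + 1\<close>, is
  definable with two universal quantifiers for irreducibility and four for minimality. Products are
  recovered from \<open>(a + b)(a + b + 1) = a (a + 1) + b (b + 1) + 2 a b\<close>. Existential witnesses for different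
  subterms are independent, and all of them can share the same six universal quantifiers.
\<close>

notation ord_omega ("\<omega>")

section \<open>Cancellation, subtraction and division of ordinals\<close>

lemma ordinal_pos_iff: "0 < \<alpha> \<longleftrightarrow> \<alpha> \<noteq> (0 :: 'a ordinal)"
  by (auto simp: order_less_le)

lemma ordinal_one_le_iff: "1 \<le> \<alpha> \<longleftrightarrow> \<alpha> \<noteq> (0 :: 'a ordinal)"
  using less_one_ordinal_iff[of \<alpha>] by (metis leD leI)

lemma ordinal_zero_times: "0 * \<alpha> = (0 :: 'a ordinal)"
proof (induction \<alpha> rule: less_induct)
  case (less \<alpha>)
  then show ?case
    using less_times_ordinal_iff[of _ 0 \<alpha>] by (metis add_0_right not_less_zero_ordinal ordinal_pos_iff)
qed

lemma ordinal_times_strict_mono: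
  assumes "0 < \<alpha>" "\<beta> < \<gamma>"
  shows "\<alpha> * \<beta> < \<alpha> * (\<gamma> :: 'a ordinal)"
  unfolding less_times_ordinal_iff[of _ \<alpha> \<gamma>]
  using assms ordinal_add_strict_mono[OF assms(1), of "\<alpha> * \<beta>"] by auto

lemma ordinal_times_left_cancel:
  assumes "\<alpha> * \<beta> = \<alpha> * \<gamma>" "\<alpha> \<noteq> (0 :: 'a ordinal)"
  shows "\<beta> = \<gamma>"
  using assms ordinal_times_strict_mono[of \<alpha>] by (metis linorder_neqE ordinal_pos_iff order_less_irrefl)

lemma ordinal_add_left_cancel:
  assumes "\<alpha> + \<beta> = \<alpha> + (\<gamma> :: 'a ordinal)"
  shows "\<beta> = \<gamma>"
  using assms ordinal_add_strict_mono[of _ _ \<alpha>] by (metis linorder_neqE order_less_irrefl)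

lemma ordinal_times_eq_zero_iff: "\<alpha> * \<beta> = 0 \<longleftrightarrow> \<alpha> = 0 \<or> \<beta> = (0 :: 'a ordinal)"
  by (metis ordinal_times_left_cancel ordinal_times_zero ordinal_zero_times)

lemma ordinal_le_add_left: "\<beta> \<le> \<alpha> + (\<beta> :: 'a ordinal)"
  using ordinal_add_right_mono[of 0 \<alpha> \<beta>] by simp

lemma ordinal_le_times_right: "\<beta> \<noteq> 0 \<Longrightarrow> \<alpha> \<le> \<alpha> * (\<beta> :: 'a ordinal)"
  using ordinal_times_mono[of 1 \<beta> \<alpha>] by (simp add: ordinal_one_le_iff)

lemma ordinal_le_times_left: "\<alpha> \<noteq> 0 \<Longrightarrow> \<beta> \<le> \<alpha> * (\<beta> :: 'a ordinal)"
  using ordinal_times_right_mono[of 1 \<alpha> \<beta>] by (simp add: ordinal_one_le_iff)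

lemma ordinal_subtraction:
  assumes "\<alpha> \<le> (\<beta> :: 'a ordinal)"
  obtains \<delta> where "\<beta> = \<alpha> + \<delta>"
proof -
  define \<delta> where "\<delta> = (LEAST \<delta>. \<beta> \<le> \<alpha> + \<delta>)"
  have 1: "\<beta> \<le> \<alpha> + \<delta>" unfolding \<delta>_def by (rule LeastI) (rule ordinal_le_add_left)
  have "\<not> \<beta> < \<alpha> + \<delta>"
    using assms not_less_Least[of _ "\<lambda>\<delta>. \<beta> \<le> \<alpha> + \<delta>"] unfolding less_plus_ordinal_iff \<delta>_def[symmetric] by auto
  then show ?thesis using 1 that by (meson leI order_antisym)
qed

text \<open>The quotient is the least \<open>\<delta>\<close> whose next multiple
  \<open>\<alpha> * \<delta> + \<alpha>\<close> exceeds \<open>\<xi>\<close>; minimality gives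
  \<open>\<alpha> * \<delta> \<le> \<xi>\<close>, and subtraction yields the remainder.\<close>

lemma ordinal_division:
  assumes "\<alpha> \<noteq> (0 :: 'a ordinal)"
  obtains \<beta> \<gamma> where "\<xi> = \<alpha> * \<beta> + \<gamma>" "\<gamma> < \<alpha>"
proof -
  define \<delta> where "\<delta> = (LEAST \<delta>. \<xi> < \<alpha> * \<delta> + \<alpha>)"
  have "\<xi> < \<alpha> * \<xi> + \<alpha>"
    using ordinal_le_times_left[OF assms] ordinal_add_strict_mono[of 0 \<alpha> "\<alpha> * \<xi>"] assms
    by (metis add_0_right le_less_trans ordinal_pos_iff)
  then have 1: "\<xi> < \<alpha> * \<delta> + \<alpha>" unfolding \<delta>_def by (rule LeastI)
  have "\<not> \<xi> < \<alpha> * \<delta>"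
    using not_less_Least[of _ "\<lambda>\<delta>. \<xi> < \<alpha> * \<delta> + \<alpha>"] unfolding less_times_ordinal_iff \<delta>_def[symmetric] by auto
  then obtain \<gamma> where \<gamma>: "\<xi> = \<alpha> * \<delta> + \<gamma>" using ordinal_subtraction by (meson leI)
  have "\<gamma> < \<alpha>" using 1 unfolding \<gamma> by (meson leI leD ordinal_add_mono)
  then show ?thesis using \<gamma> that by blast
qed

text \<open>With its remainder below \<open>\<alpha>\<close>, the side with the smaller quotient
  cannot reach the next multiple, so the quotients agree.\<close>

lemma ordinal_division_unique:
  assumes "\<alpha> * \<beta> + \<gamma> = \<alpha> * \<beta>' + \<gamma>'" "\<gamma> < \<alpha>" "\<gamma>' < (\<alpha> :: 'a ordinal)"
  shows "\<beta> = \<beta>' \<and> \<gamma> = \<gamma>'"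
proof -
  have less: "\<alpha> * \<beta> + \<gamma> < \<alpha> * \<beta>' + \<gamma>'" if "\<beta> < \<beta>'" "\<gamma> < \<alpha>" for \<beta> \<beta>' \<gamma> \<gamma>' :: "'a ordinal"
  proof -
    have "\<alpha> * \<beta> + \<gamma> < \<alpha> * \<beta>'"
      using that ordinal_add_strict_mono less_times_ordinal_iff by blast
    then show ?thesis using ordinal_le_add less_le_trans by blast
  qed
  have "\<beta> = \<beta>'"
    using assms less by (metis linorder_neqE order_less_irrefl)
  then show ?thesis using assms(1) ordinal_add_left_cancel by blast
qed

lemma ordinal_add_one_inject: "\<alpha> + 1 = \<beta> + 1 \<Longrightarrow> \<alpha> = (\<beta> :: 'a ordinal)"
  by (metis less_add_one_ordinal_iff order_antisym order_refl)

lemma ordinal_add_one_neq_zero [simp]: "\<alpha> + 1 \<noteq> (0 :: 'a ordinal)"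
  by (metis less_add_one_ordinal_iff not_less_zero_ordinal order_refl)


section \<open>Finite ordinals and \<open>\<omega>\<close>\<close>

lemma omega_neq_zero [simp]: "\<omega> \<noteq> 0"
  using limit_ordinal_omega unfolding limit_ordinal_def by blast

lemma add_one_less_omega: "n < \<omega> \<Longrightarrow> n + 1 < \<omega>"
  using limit_ordinal_omega unfolding limit_ordinal_def by blast

lemma one_less_omega [simp]: "1 < \<omega>"
  using add_one_less_omega[of 0] by (simp add: ordinal_pos_iff)

lemma less_omega_cases:
  assumes "n < \<omega>"
  obtains "n = 0" | m where "m < n" "m < \<omega>" "n = m + 1"
proof -
  have "\<not> limit_ordinal n" using assms not_less_Least unfolding ord_omega_def by blast
  then consider "n = 0" | m where "m < n" "\<not> m + 1 < n" unfolding limit_ordinal_def by blast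
  then show ?thesis
  proof cases
    case 2
    then have "n = m + 1" by (metis less_add_one_ordinal_iff leD linorder_neqE)
    then show ?thesis using 2 assms that(2)[of m] by auto
  qed (rule that)
qed

lemma less_omega_induct [consumes 1, case_names zero succ]:
  assumes "n < \<omega>" "P 0" "\<And>n. n < \<omega> \<Longrightarrow> P n \<Longrightarrow> P (n + 1)"
  shows "P n"
  using assms(1)
proof (induction n rule: less_induct)
  case (less n)
  from less.prems show ?case by (cases rule: less_omega_cases) (use less.IH assms(2,3) in auto)
qed

lemma add_less_omega: "n < \<omega> \<Longrightarrow> m < \<omega> \<Longrightarrow> m + n < \<omega>"
  by (induction n rule: less_omega_induct) (auto simp: add.assoc[symmetric] intro: add_one_less_omega)

lemma times_less_omega: "n < \<omega> \<Longrightarrow> m < \<omega> \<Longrightarrow> m * n < \<omega>"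
  by (induction n rule: less_omega_induct)
    (auto simp: ordinal_times_succ ordinal_times_zero ordinal_pos_iff intro: add_less_omega)

text \<open>Everything below \<open>n * \<omega>\<close> lies below some finite
  \<open>n * m + n\<close>.\<close>

lemma finite_times_omega:
  assumes "n < \<omega>" "n \<noteq> 0"
  shows "n * \<omega> = \<omega>"
proof (rule order_antisym)
  show "n * \<omega> \<le> \<omega>"
  proof (rule leI, rule notI)
    assume "\<omega> < n * \<omega>"
    then obtain m where "m < \<omega>" "\<omega> < n * m + n" using less_times_ordinal_iff by blast
    then show False using add_less_omega times_less_omega assms(1) by (metis order_less_asym)
  qed
qed (rule ordinal_le_times_left[OF assms(2)])

lemma one_add_omega_times: "(\<alpha> :: 'a ordinal) \<noteq> 0 \<Longrightarrow> 1 + \<omega> * \<alpha> = \<omega> * \<alpha>"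
proof -
  assume "\<alpha> \<noteq> 0"
  have "1 + \<omega> = (\<omega> :: 'a ordinal)"
  proof (rule order_antisym)
    show "1 + \<omega> \<le> (\<omega> :: 'a ordinal)"
    proof (rule leI, rule notI)
      assume "\<omega> < 1 + (\<omega> :: 'a ordinal)"
      then obtain m :: "'a ordinal" where "m < \<omega>" "\<omega> \<le> 1 + m"
        using less_plus_ordinal_iff[of \<omega> 1 "\<omega> :: 'a ordinal"] one_less_omega by (metis order_less_asym)
      then show False using add_less_omega[of m 1] by simp
    qed
  qed (rule ordinal_le_add_left)
  moreover have "1 \<le> \<alpha>" using \<open>\<alpha> \<noteq> 0\<close> by (simp add: ordinal_one_le_iff)
  then obtain \<delta> where "\<alpha> = 1 + \<delta>" using ordinal_subtraction by blast
  ultimately show ?thesis by (simp add: ordinal_distrib_left add.assoc[symmetric])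
qed

text \<open>Squeeze: \<open>\<alpha> + \<beta>\<close> is at most \<open>\<alpha> * (1 + 1)\<close>,
  and \<open>(1 + 1) * \<omega> = \<omega>\<close>. Right multiplication by \<open>\<omega>\<close>
  thus erases lower-order terms, which lets \<open>\<xi> * \<omega>\<close> measure a
  degree.\<close>

lemma add_times_omega:
  assumes "\<beta> \<le> \<alpha>" "\<alpha> \<noteq> (0 :: 'a ordinal)"
  shows "(\<alpha> + \<beta>) * \<omega> = \<alpha> * \<omega>"
proof (rule order_antisym)
  have "\<alpha> + \<beta> \<le> \<alpha> * (1 + 1)"
    using ordinal_add_mono[OF assms(1), of \<alpha>] by (simp add: ordinal_distrib_left)
  then have "(\<alpha> + \<beta>) * \<omega> \<le> \<alpha> * ((1 + 1) * \<omega>)"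
    using ordinal_times_right_mono by (metis mult.assoc)
  then show "(\<alpha> + \<beta>) * \<omega> \<le> \<alpha> * \<omega>"
    using finite_times_omega[of "1 + 1 :: 'a ordinal"] by (simp add: add_one_less_omega)
qed (rule ordinal_times_right_mono[OF ordinal_le_add])

lemma less_times_omega: "\<alpha> \<noteq> 0 \<Longrightarrow> \<alpha> < \<alpha> * \<omega>"
  using ordinal_times_strict_mono[of \<alpha> 1 \<omega>] by (simp add: ordinal_pos_iff)

lemma times_omega_eq_self_iff: "\<alpha> * \<omega> = \<alpha> \<longleftrightarrow> \<alpha> = 0"
  using less_times_omega by (metis order_less_irrefl ordinal_zero_times)

text \<open>Moves a factor \<open>\<omega>\<close> from right to left: the finite remainder of
  \<open>\<alpha>\<close> modulo \<open>\<omega>\<close> is absorbed, unless \<open>\<alpha>\<close>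
  is itself finite and the product is 0 or \<open>\<omega>\<close>.\<close>

lemma times_omega_multiple: "\<exists>\<tau>. \<alpha> * \<omega> = \<omega> * \<tau>"
proof -
  obtain \<beta> n where \<beta>: "\<alpha> = \<omega> * \<beta> + n" "n < \<omega>" using ordinal_division omega_neq_zero by metis
  consider "\<alpha> = 0" | "\<beta> = 0" "\<alpha> \<noteq> 0" | "\<beta> \<noteq> 0" by blast
  then show ?thesis
  proof cases
    case 1
    then show ?thesis by (metis ordinal_times_zero ordinal_zero_times)
  next
    case 2
    then have "\<alpha> * \<omega> = \<omega> * 1"
      using \<beta> finite_times_omega[of n] by (simp add: ordinal_times_zero)
    then show ?thesis by blast
  next
    case 3
    have "n \<le> \<omega> * \<beta>"
      using ordinal_le_times_right[OF 3] \<beta>(2) by (meson less_imp_le less_le_trans)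
    then have "\<alpha> * \<omega> = \<omega> * (\<beta> * \<omega>)"
      unfolding \<beta>(1) using 3 by (subst add_times_omega) (auto simp: ordinal_times_eq_zero_iff mult.assoc)
    then show ?thesis by blast
  qed
qed

text \<open>Modulo \<open>\<omega>\<close> the left side has remainder 0, the right side a nonzero
  one.\<close>

lemma omega_times_neq_add_one: "\<omega> * \<alpha> \<noteq> \<beta> + 1"
proof
  assume *: "\<omega> * \<alpha> = \<beta> + 1"
  obtain \<gamma> n where \<gamma>: "\<beta> = \<omega> * \<gamma> + n" "n < \<omega>" using ordinal_division[of \<omega>] omega_neq_zero by blast
  have "\<omega> * \<alpha> + 0 = \<omega> * \<gamma> + (n + 1)" using * \<gamma> by (simp add: add.assoc)
  then have "0 = n + 1"
    using ordinal_division_unique add_one_less_omega[OF \<gamma>(2)] omega_neq_zero ordinal_pos_iff by blast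
  then show False using ordinal_add_one_neq_zero by metis
qed


section \<open>Finite powers of \<open>\<omega>\<close>\<close>

lemma omega_power_neq_zero [simp]: "\<omega> ^ n \<noteq> 0"
  by (induction n) (simp_all add: ordinal_times_eq_zero_iff ordinal_pos_iff[symmetric])

lemma omega_power_less: "m < n \<Longrightarrow> (\<omega> :: 'a ordinal) ^ m < \<omega> ^ n"
proof (induction n)
  case (Suc n)
  have "(\<omega> :: 'a ordinal) ^ n < \<omega> ^ Suc n" unfolding power_Suc2 by (rule less_times_omega) simp
  moreover have "(\<omega> :: 'a ordinal) ^ m \<le> \<omega> ^ n" using Suc by (cases "m = n") auto
  ultimately show ?case by (rule le_less_trans[rotated])
qed simp

lemma omega_power_inject: "\<omega> ^ m = \<omega> ^ n \<longleftrightarrow> m = n"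
  by (metis linorder_neqE_nat omega_power_less order_less_irrefl)

lemma omega_power_eq_one_iff: "\<omega> ^ n = 1 \<longleftrightarrow> n = 0"
  using omega_power_inject[of n 0] by simp

section \<open>Degrees, read off after multiplication by \<open>\<omega>\<close> on the
  right\<close>

lemma omega_power_times_omega_inject: "(\<omega> :: 'a ordinal) ^ m * \<omega> = \<omega> ^ n * \<omega> \<longleftrightarrow> m = n"
  using omega_power_inject[of "Suc m" "Suc n", where 'a = 'a] by (simp add: power_commutes)

lemma omega_power_add_one_times_omega: "(\<omega> ^ n + 1) * \<omega> = \<omega> ^ n * \<omega>"
  by (rule add_times_omega) (simp_all add: ordinal_one_le_iff)

text \<open>The first factor of \<open>\<omega> ^ m\<close> absorbs the \<open>+ 1\<close>, hence
  the condition \<open>m > 0\<close>.\<close>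

lemma omega_power_add_one_times_power:
  "m > 0 \<Longrightarrow> (\<omega> ^ n + 1) * \<omega> ^ m = \<omega> ^ (n + m)"
  by (cases m) (simp_all add: mult.assoc[symmetric] omega_power_add_one_times_omega power_add power_commutes)

text \<open>
  Writing \<open>\<xi> = (\<omega>\<^sup>n + 1) \<beta> + \<gamma>\<close> with small \<open>\<gamma>\<close>, both sides of the commutation have
  explicit divisions by \<open>\<omega>\<^sup>n + 1\<close>, with remainders \<open>0\<close> and \<open>\<gamma>\<close>.
\<close>
lemma commuting_factor:
  fixes \<xi> :: "'a ordinal"
  assumes comm: "\<xi> * (\<omega> ^ n + 1) = (\<omega> ^ n + 1) * \<xi>"
    and deg: "\<xi> * \<omega> = \<omega> ^ m * \<omega>" and "m > 0" "n > 0"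
  obtains \<beta> where "\<xi> = (\<omega> ^ n + 1) * \<beta>" "\<beta> * (\<omega> ^ n + 1) = (\<omega> ^ n + 1) * \<beta>"
    "n \<le> m" "\<beta> * \<omega> = \<omega> ^ (m - n) * \<omega>"
proof -
  let ?s = "\<omega> ^ n + 1"
  obtain \<beta> \<gamma> where \<beta>: "\<xi> = ?s * \<beta> + \<gamma>" "\<gamma> < ?s"
    using ordinal_division[of ?s] ordinal_add_one_neq_zero by metis
  obtain k where k: "n = Suc k" using \<open>n > 0\<close> by (cases n) auto
  \<comment> \<open>Since \<open>n > 0\<close>, the degree of \<open>\<xi>\<close> determines
    \<open>\<xi> * \<omega> ^ n\<close>. This value is also a left multiple of \<open>?s\<close>,
    which turns \<open>\<xi> * ?s\<close> into a division by \<open>?s\<close> with remainder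
    \<open>\<gamma>\<close>.\<close>
  have "\<xi> * \<omega> ^ n = \<omega> ^ (n + m)"
    using deg unfolding k by (simp add: mult.assoc[symmetric] power_add power_commutes)
      (metis add.commute power_add mult.assoc)
  also have "\<dots> = ?s * \<omega> ^ m" using \<open>m > 0\<close> by (simp add: omega_power_add_one_times_power)
  finally have "\<xi> * ?s = ?s * (\<omega> ^ m + \<beta>) + \<gamma>"
    by (subst ordinal_distrib_left, subst \<beta>(1)) (simp add: ordinal_distrib_left add.assoc \<beta>(1)[symmetric])
  then have "?s * \<xi> + 0 = ?s * (\<omega> ^ m + \<beta>) + \<gamma>" using comm by simp
  then have "\<gamma> = 0"
    using ordinal_division_unique[of ?s \<xi> 0 "\<omega> ^ m + \<beta>" \<gamma>] \<beta>(2) ordinal_pos_iff[of ?s] ordinal_add_one_neq_zero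
    by metis
  then have x: "\<xi> = ?s * \<beta>" using \<beta>(1) by simp
  have "?s * (\<beta> * ?s) = ?s * (?s * \<beta>)" using comm unfolding x by (simp add: mult.assoc)
  then have c: "\<beta> * ?s = ?s * \<beta>" by (rule ordinal_times_left_cancel) simp
  have "\<beta> \<noteq> 0"
    using deg x by (metis omega_power_neq_zero omega_neq_zero ordinal_times_eq_zero_iff ordinal_times_zero)
  then have "?s \<le> \<xi>" unfolding x by (rule ordinal_le_times_right)
  then have "(\<omega> :: 'a ordinal) ^ n * \<omega> \<le> \<omega> ^ m * \<omega>"
    using ordinal_times_right_mono[of ?s \<xi> \<omega>] deg omega_power_add_one_times_omega by metis
  then have nm: "n \<le> m"
    using omega_power_less[of "Suc m" "Suc n", where 'a = 'a] unfolding power_Suc2 by (meson Suc_mono leD not_le_imp_less)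
  \<comment> \<open>The extra factor \<open>\<omega>\<close> keeps the exponent
    \<open>Suc (m - n)\<close> positive, so the \<open>+ 1\<close> in \<open>?s\<close> is absorbed
    even for \<open>m = n\<close>.\<close>
  have "?s * (\<beta> * \<omega>) = \<omega> ^ (n + Suc (m - n))"
    using deg x nm by (simp add: mult.assoc power_Suc2 del: power_Suc)
  also have "\<dots> = ?s * (\<omega> ^ (m - n) * \<omega>)"
    using omega_power_add_one_times_power[of "Suc (m - n)" n, where 'a = 'a, symmetric]
    by (simp add: power_Suc2 del: power_Suc)
  finally have "\<beta> * \<omega> = \<omega> ^ (m - n) * \<omega>" by (rule ordinal_times_left_cancel) simp
  then show ?thesis using that x c nm by blast
qed

text \<open>Every inner 1 is absorbed by the \<open>\<omega> ^ b\<close> after it and only the last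
  one survives. The infinite part \<open>\<omega> * \<eta>\<close> of \<open>\<gamma>\<close> is
  treated by associativity, the finite part by induction.\<close>

lemma omega_power_add_one_times_succ:
  fixes \<gamma> :: "'a ordinal"
  assumes "b > 0"
  shows "(\<omega> ^ b + 1) * (\<gamma> + 1) = \<omega> ^ b * (\<gamma> + 1) + 1"
proof -
  obtain \<eta> m where \<eta>: "\<gamma> = \<omega> * \<eta> + m" "m < \<omega>" using ordinal_division omega_neq_zero by metis
  obtain c where "(\<omega> :: 'a ordinal) ^ b = \<omega> * \<omega> ^ c" using assms by (cases b) auto
  then have absorb: "1 + \<omega> ^ b = (\<omega> ^ b :: 'a ordinal)" using one_add_omega_times[of "(\<omega> :: 'a ordinal) ^ c"] by simp
  have fin: "(\<omega> ^ b + 1) * (m + 1) = \<omega> ^ b * (m + 1) + 1"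
    using \<eta>(2)
  proof (induction m rule: less_omega_induct)
    case (succ n)
    then show ?case
      unfolding ordinal_times_succ[of _ "n + 1"] by (simp add: add.assoc) (simp add: add.assoc[symmetric] absorb)
  qed simp
  have "(\<omega> ^ b + 1) * (\<omega> * \<eta>) = \<omega> ^ b * (\<omega> * \<eta>)"
    by (simp add: mult.assoc[symmetric] omega_power_add_one_times_omega)
  then show ?thesis
    using fin unfolding \<eta>(1) add.assoc ordinal_distrib_left[of _ "\<omega> * \<eta>"] by (simp add: add.assoc)
qed

section \<open>Divisibility and powers expressed by commutation\<close>

lemma commuting_imp_dvd:
  fixes \<xi> :: "'a ordinal"
  assumes "\<xi> * (\<omega> ^ n + 1) = (\<omega> ^ n + 1) * \<xi>" "\<xi> * \<omega> = \<omega> ^ m * \<omega>" "n > 0"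
  shows "n dvd m"
  using assms
proof (induction m arbitrary: \<xi> rule: less_induct)
  case (less m)
  show ?case
  proof (cases "m = 0")
    case False
    \<comment> \<open>Splitting off one factor \<open>\<omega> ^ n + 1\<close> lowers the degree
      from \<open>m\<close> to \<open>m - n\<close> and preserves commutation.\<close>
    then obtain \<beta> :: "'a ordinal" where "\<beta> * (\<omega> ^ n + 1) = (\<omega> ^ n + 1) * \<beta>" "n \<le> m" "\<beta> * \<omega> = \<omega> ^ (m - n) * \<omega>"
      using commuting_factor[OF less.prems(1,2) _ less.prems(3)] by blast
    then have "n dvd m - n" using less.IH[of "m - n" \<beta>] False less.prems(3) by simp
    then show ?thesis using \<open>n \<le> m\<close> by (simp add: dvd_minus_self)
  qed simp
qed

lemma power_add_one_times_omega: "((\<omega> :: 'a ordinal) ^ n + 1) ^ j * \<omega> = \<omega> ^ (n * j) * \<omega>"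
proof (induction j)
  case (Suc j)
  have "((\<omega> :: 'a ordinal) ^ n + 1) ^ Suc j * \<omega> = (\<omega> ^ n + 1) * \<omega> ^ Suc (n * j)"
    using Suc by (simp add: mult.assoc power_commutes[of \<omega>])
  then show ?case
    using omega_power_add_one_times_power[of "Suc (n * j)" n, where 'a = 'a]
    by (simp add: power_Suc2 add.commute del: power_Suc)
qed simp

lemma dvd_iff_commuting:
  assumes "n > 0"
  shows "n dvd m \<longleftrightarrow> (\<exists>\<xi> :: 'a ordinal. \<xi> * (\<omega> ^ n + 1) = (\<omega> ^ n + 1) * \<xi> \<and> \<xi> * \<omega> = \<omega> ^ m * \<omega>)"
  proof
  assume "n dvd m"
  then obtain j where "m = n * j" by blast
  then have "(\<omega> ^ n + 1) ^ j * (\<omega> ^ n + 1) = (\<omega> ^ n + 1) * (\<omega> ^ n + 1 :: 'a ordinal) ^ j \<and>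
      (\<omega> ^ n + 1 :: 'a ordinal) ^ j * \<omega> = \<omega> ^ m * \<omega>"
    by (simp only: power_add_one_times_omega power_commutes)
  then show "\<exists>\<xi> :: 'a ordinal. \<xi> * (\<omega> ^ n + 1) = (\<omega> ^ n + 1) * \<xi> \<and> \<xi> * \<omega> = \<omega> ^ m * \<omega>" by blast
qed (use commuting_imp_dvd[OF _ _ assms] in blast)

text \<open>For uniqueness, factors \<open>\<omega> + 1\<close> are split off by
  \<open>commuting_factor\<close> until degree 0 is reached, where \<open>\<xi>\<close> is
  finite.\<close>

lemma power_omega_add_one_iff:
  "\<xi> = (\<omega> + 1 :: 'a ordinal) ^ j \<longleftrightarrow> \<xi> * (\<omega> + 1) = (\<omega> + 1) * \<xi> \<and> \<xi> * \<omega> = \<omega> ^ j * \<omega>"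
proof
  assume "\<xi> * (\<omega> + 1) = (\<omega> + 1) * \<xi> \<and> \<xi> * \<omega> = \<omega> ^ j * \<omega>"
  then show "\<xi> = (\<omega> + 1) ^ j"
  proof (induction j arbitrary: \<xi>)
    case 0
    then have comm: "\<xi> * (\<omega> + 1) = (\<omega> + 1) * \<xi>" and deg: "\<xi> * \<omega> = \<omega>" by auto
    then have nz: "\<xi> \<noteq> 0" by (metis omega_neq_zero ordinal_zero_times)
    then have "\<xi> < \<omega>" using less_times_omega deg by metis
    then obtain n where "\<xi> = n + 1" using nz by (cases rule: less_omega_cases) auto
    then have "(\<omega> + 1) * \<xi> = \<omega> * \<xi> + 1" using omega_power_add_one_times_succ[of 1 n] by simp
    \<comment> \<open>Both sides are divisions by \<open>\<omega>\<close>; comparing the quotients 1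
      and \<open>\<xi>\<close> gives \<open>\<xi> = 1\<close>.\<close>
    then have "\<omega> * 1 + \<xi> = \<omega> * \<xi> + 1"
      using comm deg by (simp add: ordinal_distrib_left)
    then show ?case
      using ordinal_division_unique[of \<omega> 1 \<xi> \<xi> 1] \<open>\<xi> < \<omega>\<close> by simp
  next
    case (Suc j)
    then obtain \<beta> where "\<xi> = (\<omega> + 1) * \<beta>" "\<beta> * (\<omega> + 1) = (\<omega> + 1) * \<beta>" "\<beta> * \<omega> = \<omega> ^ j * \<omega>"
      using commuting_factor[of \<xi> 1 "Suc j"] by auto
    then show ?case using Suc.IH by simp
  qed
qed (use power_add_one_times_omega[of 1 j] in \<open>simp add: power_commutes\<close>)

text \<open>The inequality only excludes 0. A finite nonzero \<open>\<xi>\<close> satisfies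
  \<open>\<xi> * \<omega> = \<omega>\<close>, so it must be 1; an infinite one is
  \<open>\<omega> * \<beta>\<close> with a smaller commuting \<open>\<beta>\<close>.\<close>

lemma commutes_omega_iff:
  "\<xi> * \<omega> = \<omega> * \<xi> \<and> \<xi> * \<omega> \<noteq> (\<xi> :: 'a ordinal) \<longleftrightarrow> (\<exists>k. \<xi> = \<omega> ^ k)"
proof
  assume "\<xi> * \<omega> = \<omega> * \<xi> \<and> \<xi> * \<omega> \<noteq> \<xi>"
  then show "\<exists>k. \<xi> = \<omega> ^ k"
  proof (induction \<xi> rule: less_induct)
    case (less \<xi>)
    then have comm: "\<xi> * \<omega> = \<omega> * \<xi>" and nz: "\<xi> \<noteq> 0" by (auto simp: times_omega_eq_self_iff)
    obtain \<beta> n where \<beta>: "\<xi> = \<omega> * \<beta> + n" "n < \<omega>" using ordinal_division omega_neq_zero by metis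
    show ?case
    proof (cases "\<beta> = 0")
      case True
      then have "n = \<xi>" using \<beta> by (simp add: ordinal_times_zero)
      then have "\<omega> * 1 = \<omega> * \<xi>" using comm finite_times_omega[of \<xi>] \<beta>(2) nz by simp
      then have "\<xi> = \<omega> ^ 0" using ordinal_times_left_cancel[of \<omega> 1 \<xi>] by simp
      then show ?thesis by blast
    next
      case False
      then have "\<omega> \<le> \<omega> * \<beta>" by (rule ordinal_le_times_right)
      then have "\<xi> * \<omega> = \<omega> * \<beta> * \<omega>"
        unfolding \<beta>(1) using \<beta>(2) False by (intro add_times_omega) (auto simp: ordinal_times_eq_zero_iff)
      then have "\<omega> * (\<beta> * \<omega>) = \<omega> * (\<omega> * \<beta> + n)" using comm \<beta>(1) by (simp add: mult.assoc)
      then have e: "\<beta> * \<omega> = \<omega> * \<beta> + n" by (rule ordinal_times_left_cancel) simp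
      \<comment> \<open>A left multiple of \<open>\<omega>\<close> has remainder 0, which forces
        \<open>n = 0\<close>.\<close>
      obtain \<tau> where "\<beta> * \<omega> = \<omega> * \<tau>" using times_omega_multiple by blast
      then have "n = 0"
        using e ordinal_division_unique[of \<omega> \<tau> 0 \<beta> n] \<beta>(2) ordinal_pos_iff[of "\<omega> :: 'a ordinal"] by simp
      then have \<beta>_comm: "\<beta> * \<omega> = \<omega> * \<beta>" and x: "\<xi> = \<omega> * \<beta>" using e \<beta>(1) by auto
      have "\<beta> < \<xi>" using less_times_omega[OF False] \<beta>_comm x by simp
      then obtain k where "\<beta> = \<omega> ^ k" using less.IH \<beta>_comm False times_omega_eq_self_iff by metis
      then have "\<xi> = \<omega> ^ Suc k" using x by simp
      then show ?thesis by blast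
    qed
  qed
qed (auto simp: power_commutes times_omega_eq_self_iff)


section \<open>The primes \<open>\<omega>\<^sup>n + 1\<close>\<close>

text \<open>Divide by \<open>\<omega>\<close> until a nonzero remainder appears, which makes the
  cofactor a successor; each division lowers the bound by one exponent.\<close>

lemma less_omega_power_factor:
  assumes "\<beta> < \<omega> ^ n" "\<beta> \<noteq> 0"
  obtains c \<gamma> where "\<beta> = \<omega> ^ c * (\<gamma> + 1)"
  using assms
proof (induction n arbitrary: \<beta> thesis)
  case (Suc n)
  obtain \<delta> r where \<delta>: "\<beta> = \<omega> * \<delta> + r" "r < \<omega>" using ordinal_division omega_neq_zero by metis
  from \<delta>(2) show ?case
  proof (cases rule: less_omega_cases)
    case 1
    then have "\<delta> \<noteq> 0" using \<delta>(1) Suc.prems(3) by (auto simp: ordinal_times_zero)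
    moreover have "\<delta> < \<omega> ^ n"
      using Suc.prems(2) \<delta>(1) 1 ordinal_times_mono[of "\<omega> ^ n" \<delta> \<omega>] by (metis add_0_right leD leI power_Suc)
    ultimately obtain c \<gamma> where "\<delta> = \<omega> ^ c * (\<gamma> + 1)" using Suc.IH by blast
    then have "\<beta> = \<omega> ^ Suc c * (\<gamma> + 1)" using \<delta>(1) 1 by (simp add: mult.assoc)
    then show ?thesis by (rule Suc.prems(1))
  next
    case (2 m)
    then have "\<beta> = \<omega> ^ 0 * ((\<omega> * \<delta> + m) + 1)" using \<delta>(1) by (simp add: add.assoc)
    then show ?thesis by (rule Suc.prems(1))
  qed
qed simp

text \<open>Below \<open>\<omega> ^ k * \<omega>\<close> every ordinal is bounded by a finite
  multiple of \<open>\<omega> ^ k\<close>, and finite multiples add up to finite ones.\<close>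

lemma add_less_omega_power:
  assumes "\<alpha> < \<omega> ^ n" "\<beta> < \<omega> ^ n"
  shows "\<alpha> + \<beta> < \<omega> ^ n"
proof (cases n)
  case (Suc k)
  obtain i j where ij: "i < \<omega>" "\<alpha> < \<omega> ^ k * i + \<omega> ^ k" "j < \<omega>" "\<beta> < \<omega> ^ k * j + \<omega> ^ k"
    using assms less_times_ordinal_iff[of _ "\<omega> ^ k" \<omega>] unfolding Suc power_Suc2 by blast
  have "\<alpha> + \<beta> \<le> \<omega> ^ k * (i + 1) + \<beta>"
    using ij by (intro ordinal_add_right_mono) (simp add: ordinal_times_succ)
  also have "\<dots> < \<omega> ^ k * (i + 1) + \<omega> ^ k * (j + 1)"
    using ij by (intro ordinal_add_strict_mono) (simp add: ordinal_times_succ)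
  also have "\<dots> = \<omega> ^ k * ((i + 1) + (j + 1))" by (simp only: ordinal_distrib_left)
  also have "\<dots> < \<omega> ^ k * \<omega>"
    using ij by (intro ordinal_times_strict_mono add_less_omega add_one_less_omega) (simp_all add: ordinal_pos_iff)
  finally show ?thesis unfolding Suc power_Suc2 .
qed (use assms in simp)

text \<open>Both factors are successors, because a factor that is a multiple of
  \<open>\<omega>\<close> makes the product one. Removing the last 1 would write
  \<open>\<omega> ^ n\<close> as a sum of two smaller ordinals.\<close>

lemma omega_power_add_one_prime:
  assumes "\<alpha> * \<beta> = \<omega> ^ n + 1"
  shows "\<alpha> = 1 \<or> \<beta> = 1"
proof (rule ccontr)
  assume "\<not> ?thesis"
  then have neq: "\<alpha> \<noteq> 1" "\<beta> \<noteq> 1" by auto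
  have successor: "\<exists>\<xi>'. \<xi> = \<xi>' + 1" if nlim: "\<And>\<eta>. \<xi> \<noteq> \<omega> * \<eta>" for \<xi> :: "'a ordinal"
  proof -
    obtain \<eta> m where \<eta>: "\<xi> = \<omega> * \<eta> + m" "m < \<omega>" using ordinal_division omega_neq_zero by metis
    from \<eta>(2) show ?thesis
      by (cases rule: less_omega_cases) (use \<eta>(1) nlim[of \<eta>] in \<open>auto simp: add.assoc[symmetric]\<close>)
  qed
  have "\<exists>\<alpha>'. \<alpha> = \<alpha>' + 1"
    using successor[of \<alpha>] assms omega_times_neq_add_one by (metis mult.assoc)
  then obtain \<alpha>' where a: "\<alpha> = \<alpha>' + 1" by blast
  obtain \<eta> where "\<beta> = \<eta> + 1 \<or> \<beta> = \<omega> * \<eta>" using successor[of \<beta>] by blast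
  moreover have "\<beta> \<noteq> \<omega> * \<eta>"
  proof
    assume b: "\<beta> = \<omega> * \<eta>"
    obtain \<tau> where "\<alpha> * \<omega> = \<omega> * \<tau>" using times_omega_multiple by blast
    then have "\<omega> * (\<tau> * \<eta>) = \<omega> ^ n + 1" using assms b by (simp add: mult.assoc[symmetric])
    then show False using omega_times_neq_add_one by blast
  qed
  ultimately have b: "\<beta> = \<eta> + 1" by blast
  have "\<alpha> * \<eta> + \<alpha>' = \<omega> ^ n"
    using assms unfolding b ordinal_times_succ by (subst (asm) (2) a)
      (metis add.assoc ordinal_add_one_inject)
  have nz: "\<alpha>' \<noteq> 0" "\<eta> \<noteq> 0" using neq a b by auto
  have "\<alpha> * \<eta> < \<omega> ^ n"
    using ordinal_add_strict_mono[of 0 \<alpha>' "\<alpha> * \<eta>"] nz \<open>_ = \<omega> ^ n\<close> by (simp add: ordinal_pos_iff)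
  moreover have "\<alpha>' < \<alpha> * \<eta>"
    using ordinal_le_times_right[OF nz(2), of \<alpha>] a by (metis less_add_one_ordinal_iff less_le_trans order_refl)
  ultimately show False
    using add_less_omega_power[of "\<alpha> * \<eta>" n \<alpha>'] \<open>_ = \<omega> ^ n\<close> by (metis order_less_irrefl order_less_trans)
qed

text \<open>Any other shape of \<open>\<zeta> = \<omega> * \<beta> + m\<close> factors:
  \<open>m = 0\<close> splits off \<open>\<omega>\<close> on the left, \<open>m > 1\<close> splits
  off \<open>m\<close> on the left, and a successor cofactor of \<open>\<beta>\<close> above 1
  splits off on the right. The degree then fixes the exponent.\<close>

lemma prime_eq_omega_power_add_one:
  fixes \<zeta> :: "'a ordinal"
  assumes prime: "\<And>\<alpha> \<beta>. \<alpha> * \<beta> = \<zeta> \<Longrightarrow> \<alpha> = 1 \<or> \<beta> = 1"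
    and "\<zeta> \<noteq> \<omega>" and deg: "\<zeta> * \<omega> = \<omega> ^ n * \<omega>" and "n > 0"
  shows "\<zeta> = \<omega> ^ n + 1"
proof -
  obtain \<beta> m where z: "\<zeta> = \<omega> * \<beta> + m" "m < \<omega>" using ordinal_division omega_neq_zero by metis
  have z_inf: "\<not> (\<zeta> < \<omega> \<and> \<zeta> \<noteq> 0)"
    using deg finite_times_omega[of \<zeta>] omega_power_times_omega_inject[of n 0] \<open>n > 0\<close> by auto
  have "\<zeta> \<noteq> 0" using deg by (metis omega_neq_zero omega_power_neq_zero ordinal_times_eq_zero_iff)
  then have b: "\<beta> \<noteq> 0" using z z_inf by (auto simp: ordinal_times_zero)
  have "m \<noteq> 0"
    using prime[of \<omega> \<beta>] z \<open>\<zeta> \<noteq> \<omega>\<close> one_less_omega by (metis add_0_right mult_1_right order_less_irrefl)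
  then have "m * (\<omega> * \<beta> + 1) = \<zeta>"
    by (simp add: ordinal_distrib_left mult.assoc[symmetric] finite_times_omega z)
  then have "m = 1 \<or> \<omega> * \<beta> + 1 = 1" by (rule prime)
  then have m: "m = 1"
    using b ordinal_add_one_inject[of "\<omega> * \<beta>" 0] by (auto simp: ordinal_times_eq_zero_iff)
  \<comment> \<open>A bound by a finite power of \<open>\<omega>\<close> is required to factor
    \<open>\<beta>\<close>; the degree of \<open>\<zeta>\<close> supplies it.\<close>
  have "\<beta> \<le> \<zeta>" unfolding z using ordinal_le_times_left[of \<omega> \<beta>] ordinal_le_add order_trans by force
  also have "\<zeta> < \<omega> ^ Suc n" using less_times_omega[OF \<open>\<zeta> \<noteq> 0\<close>] deg by (simp add: power_commutes)
  finally obtain c \<gamma> where "\<beta> = \<omega> ^ c * (\<gamma> + 1)" using less_omega_power_factor b by blast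
  then have "(\<omega> ^ Suc c + 1) * (\<gamma> + 1) = \<zeta>"
    by (subst omega_power_add_one_times_succ) (simp_all add: z m mult.assoc)
  moreover have "\<omega> ^ Suc c + 1 \<noteq> (1 :: 'a ordinal)"
    using ordinal_add_one_inject[of "(\<omega> :: 'a ordinal) ^ Suc c" 0] omega_power_neq_zero by (metis add_0)
  ultimately have "\<zeta> = \<omega> ^ Suc c + 1" using prime by fastforce
  moreover from this have "Suc c = n"
    using deg omega_power_add_one_times_omega omega_power_times_omega_inject by metis
  ultimately show ?thesis by simp
qed


section \<open>The domain\<close>

text \<open>Translates monoid powers into \<open>ord_exp\<close>, in which the domain is
  stated.\<close>

lemma omega_power_eq_ord_exp: "\<exists>\<delta><\<omega>. (\<omega> :: 'a ordinal) ^ n = ord_exp \<omega> \<delta>"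
proof (induction n)
  case 0
  then show ?case by (intro exI[of _ 0]) (simp add: ord_exp_zero ordinal_pos_iff)
next
  case (Suc n)
  then obtain \<delta> :: "'a ordinal" where "\<delta> < \<omega>" "\<omega> ^ n = ord_exp \<omega> \<delta>" by blast
  then show ?case
    by (intro exI[of _ "\<delta> + 1"])
      (simp add: ord_exp_succ add_one_less_omega ordinal_pos_iff power_Suc2 del: power_Suc)
qed

lemma omega_power_in_domain:
  assumes "l > (1 :: 'a ordinal)"
  shows "\<omega> ^ n \<in> domain (omega_structure l)"
proof -
  obtain \<delta> :: "'a ordinal" where \<delta>: "\<delta> < \<omega>" "\<omega> ^ n = ord_exp \<omega> \<delta>" using omega_power_eq_ord_exp by blast
  have "\<omega> = ord_exp \<omega> (0 + 1)" by (subst ord_exp_succ) (simp_all add: ord_exp_zero ordinal_pos_iff)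
  also have "\<dots> \<le> ord_exp \<omega> l" using assms by (intro ord_exp_mono) (simp_all add: ordinal_pos_iff)
  finally have "\<delta> < ord_exp \<omega> l" using \<delta>(1) by (meson less_le_trans)
  moreover have "\<omega> ^ n < ord_exp \<omega> \<delta> * \<omega>" unfolding \<delta>(2)[symmetric] by (rule less_times_omega) simp
  ultimately have "\<omega> ^ n < ord_exp \<omega> (ord_exp \<omega> l)"
    using less_ord_exp_iff[of "ord_exp \<omega> l"] by (metis not_less_zero_ordinal)
  then show ?thesis by (simp add: omega_structure_def)
qed

lemma domain_downward_closed:
  "\<beta> \<in> domain (omega_structure l) \<Longrightarrow> \<alpha> \<le> \<beta> \<Longrightarrow> \<alpha> \<in> domain (omega_structure l)"
  by (auto simp: omega_structure_def)

lemma one_in_domain: "l > 1 \<Longrightarrow> 1 \<in> domain (omega_structure l)"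
  using omega_power_in_domain[of l 0] by simp

text \<open>\<open>\<alpha> \<le> \<alpha> * \<omega> = \<omega> ^ Suc m\<close>. Knowing the degree
  of a witness is therefore enough to place it in the domain.\<close>

lemma times_omega_eq_power_in_domain:
  assumes "l > 1" "\<alpha> * \<omega> = \<omega> ^ m * \<omega>"
  shows "\<alpha> \<in> domain (omega_structure l)"
  using omega_power_in_domain[OF assms(1), of "Suc m"] ordinal_le_times_right[of \<omega> \<alpha>] assms(2)
  by (metis domain_downward_closed omega_neq_zero power_Suc2)


section \<open>Pronic numbers\<close>

text \<open>
  With \<open>N = \<omega>\<^sup>n\<close> and \<open>K = \<omega>\<^sup>k\<close>, the following expresses \<open>k = lcm n (n + 1)\<close>: the ordinals \<open>s\<close> and \<open>t\<close> are
  \<open>\<omega>\<^sup>n + 1\<close> and \<open>\<omega>\<^bsup>n+1\<^esup> + 1\<close>, tested by the factorizations \<open>\<alpha> \<beta>\<close>; \<open>\<xi>\<close> and \<open>\<eta>\<close> witness that \<open>n\<close> and \<open>n + 1\<close>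
  divide \<open>k\<close>; and no \<open>\<mu> = \<omega>\<^sup>m\<close> with \<open>0 < m < k\<close> has such witnesses \<open>\<xi>'\<close> and \<open>\<eta>'\<close>. The case \<open>n = 0\<close> is separate.
\<close>
definition pronic_kernel :: "'a ordinal \<Rightarrow> 'a ordinal \<Rightarrow> 'a ordinal \<Rightarrow> 'a ordinal \<Rightarrow> 'a ordinal \<Rightarrow>
    'a ordinal \<Rightarrow> 'a ordinal \<Rightarrow> 'a ordinal \<Rightarrow> 'a ordinal \<Rightarrow> 'a ordinal \<Rightarrow> 'a ordinal \<Rightarrow> 'a ordinal \<Rightarrow> bool" where
  "pronic_kernel N K s t \<xi> \<eta> \<alpha> \<beta> \<xi>' \<eta>' \<mu> \<delta> \<longleftrightarrow>
     (N \<noteq> 1 \<and> K \<noteq> 1) \<and>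
     ((\<alpha> * \<beta> \<noteq> s \<or> \<alpha> = 1 \<or> \<beta> = 1) \<and> s \<noteq> \<omega> \<and> s * \<omega> = N * \<omega>) \<and>
     ((\<alpha> * \<beta> \<noteq> t \<or> \<alpha> = 1 \<or> \<beta> = 1) \<and> t \<noteq> \<omega> \<and> t * \<omega> = N * \<omega> * \<omega>) \<and>
     (\<xi> * s = s * \<xi> \<and> \<xi> * \<omega> = K * \<omega>) \<and>
     (\<eta> * t = t * \<eta> \<and> \<eta> * \<omega> = K * \<omega>) \<and>
     \<not> ((\<mu> * \<omega> = \<omega> * \<mu> \<and> \<mu> * \<omega> \<noteq> \<mu>) \<and> (\<delta> * \<omega> = \<omega> * \<delta> \<and> \<delta> * \<omega> \<noteq> \<delta>) \<and> \<mu> * \<delta> = K \<and>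
        \<mu> \<noteq> 1 \<and> \<delta> \<noteq> 1 \<and> (\<xi>' * s = s * \<xi>' \<and> \<xi>' * \<omega> = \<mu> * \<omega>) \<and> (\<eta>' * t = t * \<eta>' \<and> \<eta>' * \<omega> = \<mu> * \<omega>))"

definition pronic :: "'a ordinal set \<Rightarrow> 'a ordinal \<Rightarrow> 'a ordinal \<Rightarrow> 'a ordinal \<Rightarrow> 'a ordinal \<Rightarrow>
    'a ordinal \<Rightarrow> 'a ordinal \<Rightarrow> bool" where
  "pronic D N K s t \<xi> \<eta> \<longleftrightarrow> (\<forall>\<alpha>\<in>D. \<forall>\<beta>\<in>D. \<forall>\<xi>'\<in>D. \<forall>\<eta>'\<in>D. \<forall>\<mu>\<in>D. \<forall>\<delta>\<in>D.
     (N = 1 \<and> K = 1) \<or> pronic_kernel N K s t \<xi> \<eta> \<alpha> \<beta> \<xi>' \<eta>' \<mu> \<delta>)"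

lemma consecutive_dvd_imp_pronic_dvd:
  assumes "n dvd m" "Suc n dvd m"
  shows "n * Suc n dvd (m :: nat)"
  using assms by (intro divides_mult) simp_all

lemma pronic_sound:
  assumes "l > 1" and *: "pronic (domain (omega_structure l)) (\<omega> ^ n) (\<omega> ^ k) s t \<xi> \<eta>"
  shows "k = n * Suc n"
proof (cases "n = 0")
  case True
  then show ?thesis
    using * one_in_domain[OF assms(1)] by (auto simp: pronic_def pronic_kernel_def omega_power_eq_one_iff)
next
  case False
  let ?D = "domain (omega_structure l)"
  note one = one_in_domain[OF assms(1)]
  have N: "\<omega> ^ n \<noteq> (1 :: 'a ordinal)" using False by (simp add: omega_power_eq_one_iff)
  have kernel: "pronic_kernel (\<omega> ^ n) (\<omega> ^ k) s t \<xi> \<eta> \<alpha> \<beta> \<xi>' \<eta>' \<mu> \<delta>"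
    if "\<alpha> \<in> ?D" "\<beta> \<in> ?D" "\<xi>' \<in> ?D" "\<eta>' \<in> ?D" "\<mu> \<in> ?D" "\<delta> \<in> ?D" for \<alpha> \<beta> \<xi>' \<eta>' \<mu> \<delta>
    using *[unfolded pronic_def, rule_format, OF that] N by blast
  have prime: "\<alpha> = 1 \<or> \<beta> = 1" if "\<alpha> * \<beta> = s \<or> \<alpha> * \<beta> = t" "\<alpha> \<in> ?D" "\<beta> \<in> ?D" for \<alpha> \<beta>
    using kernel[OF that(2,3) one one one one] that(1) unfolding pronic_kernel_def by blast
  \<comment> \<open>These clauses do not mention the universal variables, so any instance, here 1,
    extracts them.\<close>
  have "(\<omega> ^ k \<noteq> (1 :: 'a ordinal)) \<and> (s \<noteq> \<omega> \<and> s * \<omega> = \<omega> ^ n * \<omega>) \<and>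
      (t \<noteq> \<omega> \<and> t * \<omega> = \<omega> ^ n * \<omega> * \<omega>) \<and>
      (\<xi> * s = s * \<xi> \<and> \<xi> * \<omega> = \<omega> ^ k * \<omega>) \<and> (\<eta> * t = t * \<eta> \<and> \<eta> * \<omega> = \<omega> ^ k * \<omega>)"
    using kernel[OF one one one one one one] unfolding pronic_kernel_def by blast
  then have k: "k > 0" and s: "s \<noteq> \<omega>" "s * \<omega> = \<omega> ^ n * \<omega>"
    and t: "t \<noteq> \<omega>" "t * \<omega> = \<omega> ^ Suc n * \<omega>"
    and \<xi>: "\<xi> * s = s * \<xi>" "\<xi> * \<omega> = \<omega> ^ k * \<omega>" and \<eta>: "\<eta> * t = t * \<eta>" "\<eta> * \<omega> = \<omega> ^ k * \<omega>"
    by (auto simp: omega_power_eq_one_iff power_commutes)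
  \<comment> \<open>Irreducibility is only tested inside the domain; factors of \<open>s\<close> and
    \<open>t\<close> are bounded by them and hence lie there too.\<close>
  have factors: "\<alpha> \<in> ?D \<and> \<beta> \<in> ?D" if "\<alpha> * \<beta> = \<gamma>" "\<gamma> * \<omega> = \<omega> ^ m * \<omega>" for \<alpha> \<beta> \<gamma> m
  proof -
    have "\<gamma> \<in> ?D" by (rule times_omega_eq_power_in_domain[OF assms(1) that(2)])
    moreover have "\<gamma> \<noteq> 0"
      using that(2) by (metis omega_neq_zero omega_power_neq_zero ordinal_times_eq_zero_iff)
    then have "\<alpha> \<le> \<gamma>" "\<beta> \<le> \<gamma>"
      using that(1) ordinal_le_times_left ordinal_le_times_right ordinal_times_eq_zero_iff by blast+
    ultimately show ?thesis using domain_downward_closed by blast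
  qed
  have s_eq: "s = \<omega> ^ n + 1"
    by (rule prime_eq_omega_power_add_one) (use prime factors s False in blast)+
  have t_eq: "t = \<omega> ^ Suc n + 1"
    by (rule prime_eq_omega_power_add_one) (use prime factors t in blast)+
  have "n dvd k" "Suc n dvd k"
    using commuting_imp_dvd[of \<xi> n k] commuting_imp_dvd[of \<eta> "Suc n" k] \<xi> \<eta> s_eq t_eq False by auto
  then have "n * Suc n dvd k" by (rule consecutive_dvd_imp_pronic_dvd)
  then have "n * Suc n \<le> k" using k by (rule dvd_imp_le)
  moreover have "\<not> n * Suc n < k"
  proof
    \<comment> \<open>If \<open>k\<close> were larger, \<open>\<mu> = \<omega> ^ m\<close> and
      \<open>\<delta> = \<omega> ^ (k - m)\<close> would violate the minimality clause.\<close>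
    define m where "m = n * Suc n"
    assume "n * Suc n < k"
    then have m: "m < k" "m > 0" using False by (auto simp: m_def)
    have "n dvd m" "Suc n dvd m" unfolding m_def by (rule dvd_triv_left, rule dvd_triv_right)
    then obtain \<xi>' \<eta>' where \<xi>': "\<xi>' * s = s * \<xi>'" "\<xi>' * \<omega> = \<omega> ^ m * \<omega>"
      and \<eta>': "\<eta>' * t = t * \<eta>'" "\<eta>' * \<omega> = \<omega> ^ m * \<omega>"
      unfolding s_eq t_eq using dvd_iff_commuting[of n m] dvd_iff_commuting[of "Suc n" m] False by blast
    have pow: "\<omega> ^ i * \<omega> = \<omega> * \<omega> ^ i" "\<omega> ^ i * \<omega> \<noteq> (\<omega> ^ i :: 'a ordinal)" for i
      by (simp add: power_commutes, simp add: times_omega_eq_self_iff)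
    have "\<omega> ^ m * \<omega> ^ (k - m) = (\<omega> ^ k :: 'a ordinal)" using m by (simp add: power_add[symmetric])
    moreover have "\<omega> ^ m \<noteq> (1 :: 'a ordinal)" "\<omega> ^ (k - m) \<noteq> (1 :: 'a ordinal)"
      using m by (simp_all add: omega_power_eq_one_iff)
    moreover have "\<xi>' \<in> ?D" "\<eta>' \<in> ?D"
      using \<xi>'(2) \<eta>'(2) times_omega_eq_power_in_domain[OF assms(1)] by blast+
    ultimately show False
      using kernel[OF one one _ _ omega_power_in_domain[OF assms(1), of m]
          omega_power_in_domain[OF assms(1), of "k - m"], of \<xi>' \<eta>'] \<xi>' \<eta>' pow[of m] pow[of "k - m"]
      unfolding pronic_kernel_def by metis
  qed
  ultimately show ?thesis by simp
qed

lemma pronic_complete: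
  fixes D :: "'a ordinal set"
  shows "\<exists>s t \<xi> \<eta>. s * \<omega> = \<omega> ^ n * \<omega> \<and> t * \<omega> = \<omega> ^ Suc n * \<omega> \<and>
    \<xi> * \<omega> = \<omega> ^ (n * Suc n) * \<omega> \<and> \<eta> * \<omega> = \<omega> ^ (n * Suc n) * \<omega> \<and>
    pronic D (\<omega> ^ n) (\<omega> ^ (n * Suc n)) s t \<xi> \<eta>"
proof -
  define s t :: "'a ordinal" where st: "s = \<omega> ^ n + 1" "t = \<omega> ^ Suc n + 1"
  let ?k = "n * Suc n"
  \<comment> \<open>Exponents are chosen so that both powers have degree
    \<open>n * Suc n\<close>.\<close>
  define \<xi> \<eta> where \<xi>\<eta>: "\<xi> = s ^ Suc n" "\<eta> = t ^ n"
  have deg: "s * \<omega> = \<omega> ^ n * \<omega>" "t * \<omega> = \<omega> ^ Suc n * \<omega>"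
    unfolding st by (rule omega_power_add_one_times_omega)+
  have "\<xi> * \<omega> = \<omega> ^ ?k * \<omega>" "\<eta> * \<omega> = \<omega> ^ (Suc n * n) * \<omega>"
    unfolding \<xi>\<eta> st by (rule power_add_one_times_omega)+
  then have deg': "\<xi> * \<omega> = \<omega> ^ ?k * \<omega>" "\<eta> * \<omega> = \<omega> ^ ?k * \<omega>"
    by (simp_all only: mult.commute[of "Suc n"])
  have comm: "\<xi> * s = s * \<xi>" "\<eta> * t = t * \<eta>" unfolding \<xi>\<eta> by (rule power_commutes)+
  have "pronic D (\<omega> ^ n) (\<omega> ^ ?k) s t \<xi> \<eta>"
  proof (cases "n = 0")
    case False
    have neq: "\<omega> ^ n \<noteq> (1 :: 'a ordinal)" "\<omega> ^ ?k \<noteq> (1 :: 'a ordinal)"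
      using False by (simp_all add: omega_power_eq_one_iff del: power_Suc)
    have "\<omega> * 1 \<noteq> \<beta> + 1" for \<beta> :: "'a ordinal" by (rule omega_times_neq_add_one)
    then have "s \<noteq> \<omega>" "t \<noteq> \<omega>" unfolding st by (metis mult_1_right)+
    moreover have "\<alpha> = 1 \<or> \<beta> = 1" if "\<alpha> * \<beta> = s \<or> \<alpha> * \<beta> = t" for \<alpha> \<beta>
      using that omega_power_add_one_prime unfolding st by blast
    \<comment> \<open>Minimality: \<open>\<mu>\<close> and \<open>\<delta>\<close> are nontrivial
      powers of \<open>\<omega>\<close>, so the exponent \<open>m\<close> of \<open>\<mu>\<close>
      satisfies \<open>0 < m < ?k\<close>, yet \<open>?k\<close> divides it.\<close>
    moreover have False
      if prems: "\<mu> * \<omega> = \<omega> * \<mu> \<and> \<mu> * \<omega> \<noteq> \<mu>" "\<delta> * \<omega> = \<omega> * \<delta> \<and> \<delta> * \<omega> \<noteq> \<delta>" "\<mu> * \<delta> = \<omega> ^ ?k" "\<mu> \<noteq> 1" "\<delta> \<noteq> 1"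
        "\<xi>' * s = s * \<xi>'" "\<xi>' * \<omega> = \<mu> * \<omega>" "\<eta>' * t = t * \<eta>'" "\<eta>' * \<omega> = \<mu> * \<omega>" for \<mu> \<delta> \<xi>' \<eta>'
    proof -
      obtain m d where md: "\<mu> = \<omega> ^ m" "\<delta> = \<omega> ^ d" using prems(1,2) commutes_omega_iff by blast
      then have "m > 0" "d > 0" "m + d = ?k"
        using prems(3-5) by (auto simp: omega_power_eq_one_iff power_add[symmetric] omega_power_inject simp del: power_Suc)
      moreover have "n dvd m" "Suc n dvd m"
        using commuting_imp_dvd[of \<xi>' n m] commuting_imp_dvd[of \<eta>' "Suc n" m] prems(6-9) False
        unfolding st md by blast+
      then have "?k \<le> m" using \<open>m > 0\<close> consecutive_dvd_imp_pronic_dvd dvd_imp_le by blast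
      ultimately show False by simp
    qed
    moreover have "t * \<omega> = \<omega> ^ n * \<omega> * \<omega>" using deg(2) by (simp add: power_commutes)
    ultimately have "pronic_kernel (\<omega> ^ n) (\<omega> ^ ?k) s t \<xi> \<eta> \<alpha> \<beta> \<xi>' \<eta>' \<mu> \<delta>" for \<alpha> \<beta> \<xi>' \<eta>' \<mu> \<delta>
      unfolding pronic_kernel_def using neq deg(1) deg' comm by blast
    then show ?thesis unfolding pronic_def by blast
  qed (simp add: pronic_def)
  then show ?thesis using deg deg' by blast
qed


section \<open>Formulas\<close>

lemma val_cong: "(\<And>i. i \<in> trm_vars t \<Longrightarrow> e i = e' i) \<Longrightarrow> val M e t = val M e' t"
  by (induction t) auto

lemma sat_cong: "(\<And>i. i \<in> free_vars \<phi> \<Longrightarrow> e i = e' i) \<Longrightarrow> sat M e \<phi> \<longleftrightarrow> sat M e' \<phi>"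
proof (induction \<phi> arbitrary: e e')
  case (Eq s t)
  then show ?case using val_cong[of s e e' M] val_cong[of t e e' M] by simp
next
  case (Neg \<phi>)
  show ?case using Neg.IH[of e e'] Neg.prems by simp
next
  case (Conj \<phi> \<psi>)
  show ?case using Conj.IH(1)[of e e'] Conj.IH(2)[of e e'] Conj.prems by simp
next
  case (Disj \<phi> \<psi>)
  show ?case using Disj.IH(1)[of e e'] Disj.IH(2)[of e e'] Disj.prems by simp
next
  case (Ex i \<phi>)
  have "sat M (e(i := a)) \<phi> \<longleftrightarrow> sat M (e'(i := a)) \<phi>" for a
    by (rule Ex.IH) (use Ex.prems in auto)
  then show ?case by simp
next
  case (All i \<phi>)
  have "sat M (e(i := a)) \<phi> \<longleftrightarrow> sat M (e'(i := a)) \<phi>" for a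
    by (rule All.IH) (use All.prems in auto)
  then show ?case by simp
qed

lemma free_vars_foldr_Ex: "free_vars (foldr Ex is \<phi>) = free_vars \<phi> - set is"
  by (induction "is") auto

lemma free_vars_foldr_All: "free_vars (foldr All is \<phi>) = free_vars \<phi> - set is"
  by (induction "is") auto

lemma sat_foldr_Ex:
  "sat M e (foldr Ex is \<phi>) \<longleftrightarrow>
     (\<exists>e'. (\<forall>i. i \<notin> set is \<longrightarrow> e' i = e i) \<and> (\<forall>i\<in>set is. e' i \<in> domain M) \<and> sat M e' \<phi>)"
proof (induction "is" arbitrary: e)
  case Nil
  have "(\<forall>i. e' i = e i) \<longleftrightarrow> e' = e" for e' by auto
  then show ?case by simp
next
  case (Cons i "is")
  show ?case
  proof
    assume "sat M e (foldr Ex (i # is) \<phi>)"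
    then obtain a e' where *: "a \<in> domain M" "\<forall>j. j \<notin> set is \<longrightarrow> e' j = (e(i := a)) j"
      "\<forall>j\<in>set is. e' j \<in> domain M" "sat M e' \<phi>"
      using Cons.IH by auto
    have "e' i \<in> domain M" using *(1-3) by (cases "i \<in> set is") auto
    then show "\<exists>e'. (\<forall>j. j \<notin> set (i # is) \<longrightarrow> e' j = e j) \<and> (\<forall>j\<in>set (i # is). e' j \<in> domain M) \<and> sat M e' \<phi>"
      using * by (intro exI[of _ e']) auto
  next
    assume "\<exists>e'. (\<forall>j. j \<notin> set (i # is) \<longrightarrow> e' j = e j) \<and> (\<forall>j\<in>set (i # is). e' j \<in> domain M) \<and> sat M e' \<phi>"
    then obtain e' where "\<forall>j. j \<notin> set (i # is) \<longrightarrow> e' j = e j" "\<forall>j\<in>set (i # is). e' j \<in> domain M" "sat M e' \<phi>"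
      by blast
    then have "sat M (e(i := e' i)) (foldr Ex is \<phi>)" "e' i \<in> domain M"
      unfolding Cons.IH by (auto intro: exI[of _ e'])
    then show "sat M e (foldr Ex (i # is) \<phi>)" by auto
  qed
qed

text \<open>Lets any number of subformulas share one block of universal quantifiers.\<close>

lemma sat_foldr_All_Conj:
  "sat M e (foldr All is (Conj \<phi> \<psi>)) \<longleftrightarrow> sat M e (foldr All is \<phi>) \<and> sat M e (foldr All is \<psi>)"
  by (induction "is" arbitrary: e) auto

lemma sat_foldr_All_vacuous:
  assumes "domain M \<noteq> {}" "set is \<inter> free_vars \<phi> = {}"
  shows "sat M e (foldr All is \<phi>) \<longleftrightarrow> sat M e \<phi>"
  using assms(2)
proof (induction "is" arbitrary: e)
  case (Cons i "is")
  have "sat M (e(i := a)) \<phi> \<longleftrightarrow> sat M e \<phi>" for a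
    by (rule sat_cong) (use Cons.prems in auto)
  then show ?case using Cons assms(1) by auto
qed simp

text \<open>Indices below \<open>p\<close> are the free variables, these six the universal block;
  existential variables start at \<open>p + 6\<close>.\<close>

definition univ_vars :: "nat \<Rightarrow> nat list" where
  "univ_vars p = [p, p + 1, p + 2, p + 3, p + 4, p + 5]"

lemma set_univ_vars: "set (univ_vars p) = {p..<p + 6}"
  by (auto simp: univ_vars_def)

section \<open>Formulas for powers of \<open>\<omega>\<close>, pronic numbers and products\<close>

type_synonym omega_trm = "(omega_const, omega_op) trm"
type_synonym omega_fm = "(omega_const, omega_op) fm"

abbreviation times_trm :: "omega_trm \<Rightarrow> omega_trm \<Rightarrow> omega_trm" (infixl "\<otimes>" 70) where
  "s \<otimes> t \<equiv> Bin O_times s t"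

definition power_fm :: "omega_trm \<Rightarrow> omega_fm" where
  "power_fm t = Conj (Eq (t \<otimes> Const C_omega) (Const C_omega \<otimes> t)) (Neg (Eq (t \<otimes> Const C_omega) t))"

text \<open>\<open>a\<close> and \<open>b\<close> are meant to be universal variables. For
  \<open>N = \<omega> ^ n\<close> with \<open>n > 0\<close> this then pins \<open>s\<close> down to
  \<open>\<omega> ^ n + 1\<close>.\<close>

definition prime_fm :: "omega_trm \<Rightarrow> omega_trm \<Rightarrow> omega_trm \<Rightarrow> omega_trm \<Rightarrow> omega_fm" where
  "prime_fm s N a b =
     Conj (Disj (Neg (Eq (a \<otimes> b) s)) (Disj (Eq a (Const C_one)) (Eq b (Const C_one))))
       (Conj (Neg (Eq s (Const C_omega))) (Eq (s \<otimes> Const C_omega) (N \<otimes> Const C_omega)))"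

text \<open>For \<open>s = \<omega> ^ n + 1\<close> with \<open>n > 0\<close> and
  \<open>K = \<omega> ^ k\<close>, such an \<open>x\<close> witnesses that \<open>n\<close> divides
  \<open>k\<close>.\<close>

definition multiple_fm :: "omega_trm \<Rightarrow> omega_trm \<Rightarrow> omega_trm \<Rightarrow> omega_fm" where
  "multiple_fm s x K = Conj (Eq (x \<otimes> s) (s \<otimes> x)) (Eq (x \<otimes> Const C_omega) (K \<otimes> Const C_omega))"

text \<open>\<open>p\<close> and \<open>p + 1\<close> are the candidate factors in both
  irreducibility tests, \<open>p + 2\<close> and \<open>p + 3\<close> the commuting witnesses to be
  refuted, \<open>p + 4\<close> and \<open>p + 5\<close> the ordinals \<open>\<mu>\<close> and
  \<open>\<delta>\<close>.\<close>

definition pronic_fm :: "nat \<Rightarrow> omega_trm \<Rightarrow> omega_trm \<Rightarrow> omega_trm \<Rightarrow> omega_trm \<Rightarrow> omega_trm \<Rightarrow> omega_trm \<Rightarrow> omega_fm" where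
  "pronic_fm p N K s t x y =
     Disj (Conj (Eq N (Const C_one)) (Eq K (Const C_one)))
       (Conj (Conj (Neg (Eq N (Const C_one))) (Neg (Eq K (Const C_one))))
         (Conj (prime_fm s N (Var p) (Var (p + 1)))
           (Conj (prime_fm t (N \<otimes> Const C_omega) (Var p) (Var (p + 1)))
             (Conj (multiple_fm s x K)
               (Conj (multiple_fm t y K)
                 (Neg (Conj (power_fm (Var (p + 4)))
                   (Conj (power_fm (Var (p + 5)))
                     (Conj (Eq (Var (p + 4) \<otimes> Var (p + 5)) K)
                       (Conj (Neg (Eq (Var (p + 4)) (Const C_one)))
                         (Conj (Neg (Eq (Var (p + 5)) (Const C_one)))
                           (Conj (multiple_fm s (Var (p + 2)) (Var (p + 4)))
                             (multiple_fm t (Var (p + 3)) (Var (p + 4)))))))))))))))"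

text \<open>Variable \<open>k\<close> carries the product of the exponents \<open>i\<close> and
  \<open>j\<close> of \<open>a\<close> and \<open>b\<close>; the next three carry the pronic numbers
  of \<open>i\<close>, \<open>j\<close> and \<open>i + j\<close>, related by the identity for
  \<open>2 * i * j\<close>. The other twelve are witnesses, four for each pronic number.\<close>

definition product_fm :: "nat \<Rightarrow> omega_trm \<Rightarrow> omega_trm \<Rightarrow> nat \<Rightarrow> omega_fm" where
  "product_fm p a b k =
     Conj (Conj (Conj (power_fm (Var k)) (power_fm (Var (k + 1))))
         (Conj (Conj (power_fm (Var (k + 2))) (power_fm (Var (k + 3))))
            (Eq (Var (k + 3)) (Var (k + 1) \<otimes> Var (k + 2) \<otimes> (Var k \<otimes> Var k)))))
       (Conj (pronic_fm p a (Var (k + 1)) (Var (k + 4)) (Var (k + 5)) (Var (k + 6)) (Var (k + 7)))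
         (Conj (pronic_fm p b (Var (k + 2)) (Var (k + 8)) (Var (k + 9)) (Var (k + 10)) (Var (k + 11)))
           (pronic_fm p (a \<otimes> b) (Var (k + 3)) (Var (k + 12)) (Var (k + 13)) (Var (k + 14)) (Var (k + 15)))))"

lemma omega_structure_simps [simp]:
  "bin_of (omega_structure l) O_times = (*)"
  "const_of (omega_structure l) C_one = 1"
  "const_of (omega_structure l) C_omega = \<omega>"
  "const_of (omega_structure l) C_omega_plus_one = \<omega> + 1"
  by (simp_all add: omega_structure_def)

lemma nat_structure_simps [simp]:
  "bin_of nat_structure NPlus = (+)"
  "bin_of nat_structure NTimes = (*)"
  "const_of nat_structure NZero = 0"
  "const_of nat_structure NOne = 1"
  by (simp_all add: nat_structure_def)

lemma sat_power_fm:
  "sat (omega_structure l) e (power_fm t) \<longleftrightarrow> (\<exists>k. val (omega_structure l) e t = \<omega> ^ k)"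
  using commutes_omega_iff[of "val (omega_structure l) e t"] by (simp add: power_fm_def)

lemma free_vars_power_fm: "free_vars (power_fm t) = trm_vars t"
  by (auto simp: power_fm_def)

lemma sat_pronic_fm:
  assumes "(trm_vars N \<union> trm_vars K \<union> trm_vars s \<union> trm_vars t \<union> trm_vars x \<union> trm_vars y) \<inter> {p..<p + 6} = {}"
  shows "sat (omega_structure l) e (foldr All (univ_vars p) (pronic_fm p N K s t x y)) \<longleftrightarrow>
    pronic (domain (omega_structure l)) (val (omega_structure l) e N) (val (omega_structure l) e K)
      (val (omega_structure l) e s) (val (omega_structure l) e t)
      (val (omega_structure l) e x) (val (omega_structure l) e y)"
proof -
  have [simp]: "val (omega_structure l) (e(p := a, Suc p := b, Suc (Suc p) := c, p + 3 := d, p + 4 := f, p + 5 := g)) u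
      = val (omega_structure l) e u" if "u \<in> {N, K, s, t, x, y}" for u a b c d f g
  proof (rule val_cong)
    fix i assume "i \<in> trm_vars u"
    then have "i \<notin> {p..<p + 6}" using assms that by blast
    then show "(e(p := a, Suc p := b, Suc (Suc p) := c, p + 3 := d, p + 4 := f, p + 5 := g)) i = e i" by auto
  qed
  show ?thesis
    by (simp add: univ_vars_def pronic_fm_def prime_fm_def multiple_fm_def power_fm_def pronic_def pronic_kernel_def)
qed

lemma quantifier_free_product_fm: "quantifier_free (product_fm p a b k)"
  by (simp add: product_fm_def pronic_fm_def prime_fm_def multiple_fm_def power_fm_def)

lemma free_vars_pronic_fm:
  "free_vars (pronic_fm p N K s t x y) \<subseteq>
     trm_vars N \<union> trm_vars K \<union> trm_vars s \<union> trm_vars t \<union> trm_vars x \<union> trm_vars y \<union> {p..<p + 6}"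
  by (simp add: pronic_fm_def prime_fm_def multiple_fm_def power_fm_def) blast

lemma free_vars_product_fm:
  "free_vars (product_fm p a b k) \<subseteq> trm_vars a \<union> trm_vars b \<union> {p..<p + 6} \<union> {k..<k + 16}"
proof -
  have var: "trm_vars (Var (k + i) :: omega_trm) \<subseteq> {k..<k + 16}" if "i < 16" for i using that by simp
  have pronic: "free_vars (pronic_fm p u (Var (k + i)) (Var (k + f)) (Var (k + g)) (Var (k + h)) (Var (k + h')))
      \<subseteq> trm_vars a \<union> trm_vars b \<union> {p..<p + 6} \<union> {k..<k + 16}"
    if "trm_vars u \<subseteq> trm_vars a \<union> trm_vars b" "i < 16" "f < 16" "g < 16" "h < 16" "h' < 16" for u i f g h h'
    using free_vars_pronic_fm[of p u "Var (k + i)" "Var (k + f)" "Var (k + g)" "Var (k + h)" "Var (k + h')"]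
      var[OF that(2)] var[OF that(3)] var[OF that(4)] var[OF that(5)] var[OF that(6)] that(1) by blast
  show ?thesis
    unfolding product_fm_def free_vars.simps
    by (intro Un_least pronic) (simp_all add: free_vars_power_fm)
qed

lemma sat_product_fm:
  assumes "(trm_vars a \<union> trm_vars b) \<inter> {p..<p + 6} = {}" "p + 6 \<le> k" and "l > 1"
    and a: "val (omega_structure l) e a = \<omega> ^ i" and b: "val (omega_structure l) e b = \<omega> ^ j"
  shows "sat (omega_structure l) e (foldr All (univ_vars p) (product_fm p a b k)) \<longleftrightarrow>
    (\<exists>c m n q. e k = \<omega> ^ c \<and> e (k + 1) = \<omega> ^ m \<and> e (k + 2) = \<omega> ^ n \<and> e (k + 3) = \<omega> ^ q \<and> q = m + n + 2 * c \<and>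
      pronic (domain (omega_structure l)) (\<omega> ^ i) (\<omega> ^ m) (e (k + 4)) (e (k + 5)) (e (k + 6)) (e (k + 7)) \<and>
      pronic (domain (omega_structure l)) (\<omega> ^ j) (\<omega> ^ n) (e (k + 8)) (e (k + 9)) (e (k + 10)) (e (k + 11)) \<and>
      pronic (domain (omega_structure l)) (\<omega> ^ (i + j)) (\<omega> ^ q) (e (k + 12)) (e (k + 13)) (e (k + 14)) (e (k + 15)))"
    (is "_ \<longleftrightarrow> ?R")
proof -
  let ?M = "omega_structure l"
  have ne: "domain ?M \<noteq> {}" using one_in_domain[OF \<open>l > 1\<close>] by blast
  \<comment> \<open>The head avoids the universal block, so the quantifiers drop out and its
    equation becomes addition of exponents.\<close>
  have head: "sat ?M e (foldr All (univ_vars p) (Conj (Conj (power_fm (Var k)) (power_fm (Var (k + 1))))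
         (Conj (Conj (power_fm (Var (k + 2))) (power_fm (Var (k + 3))))
            (Eq (Var (k + 3)) (Var (k + 1) \<otimes> Var (k + 2) \<otimes> (Var k \<otimes> Var k)))))) \<longleftrightarrow>
      (\<exists>c m n q. e k = \<omega> ^ c \<and> e (k + 1) = \<omega> ^ m \<and> e (k + 2) = \<omega> ^ n \<and> e (k + 3) = \<omega> ^ q \<and> q = m + n + 2 * c)"
    (is "?L \<longleftrightarrow> ?H")
  proof -
    have "?L \<longleftrightarrow> (\<exists>c. e k = \<omega> ^ c) \<and> (\<exists>c. e (k + 1) = \<omega> ^ c) \<and> (\<exists>c. e (k + 2) = \<omega> ^ c) \<and> (\<exists>c. e (k + 3) = \<omega> ^ c)
        \<and> e (k + 3) = e (k + 1) * e (k + 2) * (e k * e k)"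
      using \<open>p + 6 \<le> k\<close>
      by (subst sat_foldr_All_vacuous[OF ne]) (auto simp: set_univ_vars free_vars_power_fm sat_power_fm)
    also have "\<dots> \<longleftrightarrow> ?H"
      by (auto simp: power_add[symmetric] omega_power_inject mult_2 add.assoc)
    finally show ?thesis .
  qed
  have pronics: "sat ?M e (foldr All (univ_vars p) (pronic_fm p u (Var (k + r)) (Var (k + f)) (Var (k + g)) (Var (k + h)) (Var (k + h')))) \<longleftrightarrow>
      pronic (domain ?M) (val ?M e u) (e (k + r)) (e (k + f)) (e (k + g)) (e (k + h)) (e (k + h'))"
    if "u \<in> {a, b, a \<otimes> b}" for u r f g h h'
    using assms(1,2) that by (subst sat_pronic_fm) auto
  have ab: "val ?M e (a \<otimes> b) = \<omega> ^ (i + j)" using a b by (simp add: power_add)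
  have "sat ?M e (foldr All (univ_vars p) (product_fm p a b k)) \<longleftrightarrow>
      (\<exists>c m n q. e k = \<omega> ^ c \<and> e (k + 1) = \<omega> ^ m \<and> e (k + 2) = \<omega> ^ n \<and> e (k + 3) = \<omega> ^ q \<and> q = m + n + 2 * c) \<and>
      pronic (domain ?M) (\<omega> ^ i) (e (k + 1)) (e (k + 4)) (e (k + 5)) (e (k + 6)) (e (k + 7)) \<and>
      pronic (domain ?M) (\<omega> ^ j) (e (k + 2)) (e (k + 8)) (e (k + 9)) (e (k + 10)) (e (k + 11)) \<and>
      pronic (domain ?M) (\<omega> ^ (i + j)) (e (k + 3)) (e (k + 12)) (e (k + 13)) (e (k + 14)) (e (k + 15))"
    (is "_ \<longleftrightarrow> _ \<and> ?P1 \<and> ?P2 \<and> ?P3")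
    unfolding product_fm_def sat_foldr_All_Conj[of _ _ _ "Conj (Conj _ _) _"] head
      sat_foldr_All_Conj[of _ _ _ "pronic_fm _ _ _ _ _ _ _"]
    by (subst pronics, simp, subst pronics, simp, subst pronics, simp) (unfold a b ab, rule refl)
  also have "\<dots> \<longleftrightarrow> ?R"
    by (simp only: ex_simps(1)[symmetric]) (rule ex_cong1, rule ex_cong1, rule ex_cong1, rule ex_cong1, auto)
  finally show ?thesis .
qed

lemma product_fm_sound:
  assumes "(trm_vars a \<union> trm_vars b) \<inter> {p..<p + 6} = {}" "p + 6 \<le> k" "l > 1"
    and "val (omega_structure l) e a = \<omega> ^ i" "val (omega_structure l) e b = \<omega> ^ j"
    and "sat (omega_structure l) e (foldr All (univ_vars p) (product_fm p a b k))"
  shows "e k = \<omega> ^ (i * j)"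
proof -
  obtain c m n q where c: "e k = \<omega> ^ c" "q = m + n + 2 * c" and
    pr: "pronic (domain (omega_structure l)) (\<omega> ^ i) (\<omega> ^ m) (e (k + 4)) (e (k + 5)) (e (k + 6)) (e (k + 7))"
      "pronic (domain (omega_structure l)) (\<omega> ^ j) (\<omega> ^ n) (e (k + 8)) (e (k + 9)) (e (k + 10)) (e (k + 11))"
      "pronic (domain (omega_structure l)) (\<omega> ^ (i + j)) (\<omega> ^ q) (e (k + 12)) (e (k + 13)) (e (k + 14)) (e (k + 15))"
    using assms(6) unfolding sat_product_fm[OF assms(1-5)] by blast
  have "m = i * Suc i" "n = j * Suc j" "q = (i + j) * Suc (i + j)"
    using pr by (auto dest: pronic_sound[OF assms(3)])
  then have "c = i * j" using c(2) by (simp add: algebra_simps)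
  then show ?thesis using c(1) by simp
qed

lemma product_fm_complete:
  assumes "(trm_vars a \<union> trm_vars b) \<inter> {p..<p + 6} = {}" "p + 6 \<le> k" "l > 1"
    and a: "val (omega_structure l) e a = \<omega> ^ i" "trm_vars a \<subseteq> {..<k}"
    and b: "val (omega_structure l) e b = \<omega> ^ j" "trm_vars b \<subseteq> {..<k}"
  shows "\<exists>e'. (\<forall>i. i \<notin> {k..<k + 16} \<longrightarrow> e' i = e i) \<and> (\<forall>i\<in>{k..<k + 16}. e' i \<in> domain (omega_structure l)) \<and>
    sat (omega_structure l) e' (foldr All (univ_vars p) (product_fm p a b k))"
proof -
  let ?M = "omega_structure l"
  let ?D = "domain ?M"
  have ex: "\<exists>s t \<xi> \<eta>. s \<in> ?D \<and> t \<in> ?D \<and> \<xi> \<in> ?D \<and> \<eta> \<in> ?D \<and> pronic ?D (\<omega> ^ n) (\<omega> ^ (n * Suc n)) s t \<xi> \<eta>" for n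
    using pronic_complete[of n ?D] times_omega_eq_power_in_domain[OF \<open>l > 1\<close>] by blast
  obtain s1 t1 x1 y1 where 1: "s1 \<in> ?D" "t1 \<in> ?D" "x1 \<in> ?D" "y1 \<in> ?D"
    "pronic ?D (\<omega> ^ i) (\<omega> ^ (i * Suc i)) s1 t1 x1 y1" using ex[of i] by blast
  obtain s2 t2 x2 y2 where 2: "s2 \<in> ?D" "t2 \<in> ?D" "x2 \<in> ?D" "y2 \<in> ?D"
    "pronic ?D (\<omega> ^ j) (\<omega> ^ (j * Suc j)) s2 t2 x2 y2" using ex[of j] by blast
  obtain s3 t3 x3 y3 where 3: "s3 \<in> ?D" "t3 \<in> ?D" "x3 \<in> ?D" "y3 \<in> ?D"
    "pronic ?D (\<omega> ^ (i + j)) (\<omega> ^ ((i + j) * Suc (i + j))) s3 t3 x3 y3" using ex[of "i + j"] by blast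
  \<comment> \<open>The order follows the offsets from \<open>k\<close> in
    \<open>product_fm\<close>.\<close>
  define ws where "ws = [\<omega> ^ (i * j), \<omega> ^ (i * Suc i), \<omega> ^ (j * Suc j), \<omega> ^ ((i + j) * Suc (i + j)),
    s1, t1, x1, y1, s2, t2, x2, y2, s3, t3, x3, y3]"
  define e' where "e' r = (if r \<in> {k..<k + 16} then ws ! (r - k) else e r)" for r
  have len: "length ws = 16" by (simp add: ws_def)
  have "set ws \<subseteq> ?D" unfolding ws_def using 1 2 3 omega_power_in_domain[OF \<open>l > 1\<close>] by auto
  then have dom: "\<forall>r\<in>{k..<k + 16}. e' r \<in> ?D"
    unfolding e'_def using len nth_mem[of _ ws] by (auto simp: subset_iff)
  have nth: "e' k = ws ! 0" "e' (k + 1) = ws ! 1" "e' (k + 2) = ws ! 2" "e' (k + 3) = ws ! 3"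
    "e' (k + 4) = ws ! 4" "e' (k + 5) = ws ! 5" "e' (k + 6) = ws ! 6" "e' (k + 7) = ws ! 7"
    "e' (k + 8) = ws ! 8" "e' (k + 9) = ws ! 9" "e' (k + 10) = ws ! 10" "e' (k + 11) = ws ! 11"
    "e' (k + 12) = ws ! 12" "e' (k + 13) = ws ! 13" "e' (k + 14) = ws ! 14" "e' (k + 15) = ws ! 15"
    by (simp_all add: e'_def)
  have "val ?M e' a = \<omega> ^ i" "val ?M e' b = \<omega> ^ j"
    unfolding a(1)[symmetric] b(1)[symmetric] using a(2) b(2) by (auto intro!: val_cong simp: e'_def)
  note sat = sat_product_fm[OF assms(1-3) this]
  have "(i + j) * Suc (i + j) = i * Suc i + j * Suc j + 2 * (i * j)" by (simp add: algebra_simps)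
  then have "sat ?M e' (foldr All (univ_vars p) (product_fm p a b k))"
    unfolding sat using 1(5) 2(5) 3(5) nth
    by (intro exI[of _ "i * j"] exI[of _ "i * Suc i"] exI[of _ "j * Suc j"] exI[of _ "(i + j) * Suc (i + j)"] conjI)
      (simp_all add: ws_def del: power_Suc mult_Suc mult_Suc_right)
  then show ?thesis using dom by (intro exI[of _ e']) (auto simp: e'_def)
qed


section \<open>Terms\<close>

text \<open>
  The exponent of the variable \<open>x\<^sub>i\<close> is held as \<open>\<omega>\<^bsup>j\<^esup>\<close> in variable \<open>p + 6 + i\<close>, after the free
  variables and the six universally quantified ones; variables \<open>k, \<dots>, k' - 1\<close> are auxiliary.
\<close>
definition encodes :: "'a ordinal \<Rightarrow> nat \<Rightarrow> (nat_const, nat_op) trm \<Rightarrow> nat \<Rightarrow> nat \<Rightarrow> omega_trm \<Rightarrow> omega_fm \<Rightarrow> bool" where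
  "encodes l p t k k' r \<phi> \<longleftrightarrow> k \<le> k' \<and> quantifier_free \<phi> \<and> trm_vars r \<subseteq> {p + 6..<k'} \<and> free_vars \<phi> \<subseteq> {p..<k'} \<and>
     (\<forall>e j. (\<forall>i<p. e (p + 6 + i) = \<omega> ^ j i) \<longrightarrow> sat (omega_structure l) e (foldr All (univ_vars p) \<phi>) \<longrightarrow>
        val (omega_structure l) e r = \<omega> ^ val nat_structure j t) \<and>
     (\<forall>e j. (\<forall>i<p. e (p + 6 + i) = \<omega> ^ j i) \<longrightarrow>
        (\<exists>e'. (\<forall>i. i \<notin> {k..<k'} \<longrightarrow> e' i = e i) \<and> (\<forall>i\<in>{k..<k'}. e' i \<in> domain (omega_structure l)) \<and>
           sat (omega_structure l) e' (foldr All (univ_vars p) \<phi>)))"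

lemma encodes_sound:
  assumes "encodes l p t k k' r \<phi>" "\<And>i. i < p \<Longrightarrow> e (p + 6 + i) = \<omega> ^ j i"
    and "sat (omega_structure l) e (foldr All (univ_vars p) \<phi>)"
  shows "val (omega_structure l) e r = \<omega> ^ val nat_structure j t"
  using assms unfolding encodes_def by blast

lemma encodes_pair_vars:
  assumes "encodes l p s k k1 r1 \<phi>1" "encodes l p t k1 k2 r2 \<phi>2"
  shows "k \<le> k1" "k1 \<le> k2" "quantifier_free \<phi>1" "quantifier_free \<phi>2"
    "trm_vars r1 \<subseteq> {p + 6..<k2}" "trm_vars r2 \<subseteq> {p + 6..<k2}" "free_vars \<phi>1 \<subseteq> {p..<k2}" "free_vars \<phi>2 \<subseteq> {p..<k2}"
proof -
  show le: "k \<le> k1" "k1 \<le> k2" and "quantifier_free \<phi>1" "quantifier_free \<phi>2"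
    and "trm_vars r2 \<subseteq> {p + 6..<k2}" "free_vars \<phi>2 \<subseteq> {p..<k2}"
    using assms unfolding encodes_def by blast+
  have "trm_vars r1 \<subseteq> {p + 6..<k1}" "free_vars \<phi>1 \<subseteq> {p..<k1}"
    using assms(1) unfolding encodes_def by blast+
  moreover have "{p + 6..<k1} \<subseteq> {p + 6..<k2}" "{p..<k1} \<subseteq> {p..<k2}" using le by auto
  ultimately show "trm_vars r1 \<subseteq> {p + 6..<k2}" "free_vars \<phi>1 \<subseteq> {p..<k2}" by blast+
qed

text \<open>Witnesses for \<open>t\<close> are chosen after those for \<open>s\<close> in a fresh
  block from \<open>k1\<close> on, which leaves \<open>\<phi>1\<close> true because its variables
  lie below \<open>k1\<close>.\<close>

lemma encodes_pair_complete:
  assumes s: "encodes l p s k k1 r1 \<phi>1" and t: "encodes l p t k1 k2 r2 \<phi>2" and k: "2 * p + 6 \<le> k"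
    and e: "\<And>i. i < p \<Longrightarrow> e (p + 6 + i) = \<omega> ^ j i"
  obtains e' where "\<And>i. i \<notin> {k..<k2} \<Longrightarrow> e' i = e i" "\<And>i. i \<in> {k..<k2} \<Longrightarrow> e' i \<in> domain (omega_structure l)"
    "sat (omega_structure l) e' (foldr All (univ_vars p) (Conj \<phi>1 \<phi>2))"
    "val (omega_structure l) e' r1 = \<omega> ^ val nat_structure j s"
    "val (omega_structure l) e' r2 = \<omega> ^ val nat_structure j t"
proof -
  let ?M = "omega_structure l"
  note le = encodes_pair_vars(1,2)[OF s t]
  obtain e1 where e1: "\<And>i. i \<notin> {k..<k1} \<Longrightarrow> e1 i = e i" "\<And>i. i \<in> {k..<k1} \<Longrightarrow> e1 i \<in> domain ?M"
    "sat ?M e1 (foldr All (univ_vars p) \<phi>1)"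
    using s e unfolding encodes_def by metis
  have "e1 (p + 6 + i) = \<omega> ^ j i" if "i < p" for i using e1(1) e that k by simp
  then obtain e2 where e2: "\<And>i. i \<notin> {k1..<k2} \<Longrightarrow> e2 i = e1 i" "\<And>i. i \<in> {k1..<k2} \<Longrightarrow> e2 i \<in> domain ?M"
    "sat ?M e2 (foldr All (univ_vars p) \<phi>2)"
    using t unfolding encodes_def by metis
  have agree: "e2 i = e i" if "i \<notin> {k..<k2}" for i
  proof -
    have "i \<notin> {k..<k1}" "i \<notin> {k1..<k2}" using that le by auto
    then show ?thesis using e1(1) e2(1) by metis
  qed
  then have e2_y: "e2 (p + 6 + i) = \<omega> ^ j i" if "i < p" for i using e that k by simp
  have "sat ?M e2 (foldr All (univ_vars p) \<phi>1) \<longleftrightarrow> sat ?M e1 (foldr All (univ_vars p) \<phi>1)"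
  proof (rule sat_cong)
    fix i assume "i \<in> free_vars (foldr All (univ_vars p) \<phi>1)"
    then have "i < k1" using s unfolding encodes_def free_vars_foldr_All by auto
    then show "e2 i = e1 i" using e2(1) by simp
  qed
  then have sat1: "sat ?M e2 (foldr All (univ_vars p) \<phi>1)" using e1(3) by blast
  have vals: "val ?M e2 r1 = \<omega> ^ val nat_structure j s" "val ?M e2 r2 = \<omega> ^ val nat_structure j t"
    using encodes_sound[OF s, of e2 j] encodes_sound[OF t, of e2 j] e2_y sat1 e2(3) by blast+
  show ?thesis
  proof (rule that[of e2])
    show "e2 i \<in> domain ?M" if "i \<in> {k..<k2}" for i
      using that e1(2)[of i] e2(1)[of i] e2(2)[of i] by (cases "i < k1") auto
  qed (use agree sat1 e2(3) vals in \<open>auto simp: sat_foldr_All_Conj\<close>)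
qed

lemma ex_encodes:
  fixes l :: "'a ordinal"
  assumes "l > 1" "trm_vars t \<subseteq> {..<p}" "2 * p + 6 \<le> k"
  shows "\<exists>k' r \<phi>. encodes l p t k k' r \<phi>"
  using assms(2,3)
proof (induction t arbitrary: k)
  case (Var i)
  have "encodes l p (Var i) k k (Var (p + 6 + i)) (Eq (Const C_one) (Const C_one))"
    using Var by (auto simp: encodes_def univ_vars_def)
  then show ?case by blast
next
  case (Const c)
  \<comment> \<open>0 and 1 are the exponents of \<open>1\<close> and \<open>\<omega>\<close>; a
    trivially true equation stands for the absent constraint.\<close>
  have "encodes l p (Const NZero) k k (Const C_one) (Eq (Const C_one) (Const C_one))"
    "encodes l p (Const NOne) k k (Const C_omega) (Eq (Const C_one) (Const C_one))"
    by (auto simp: encodes_def univ_vars_def)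
  then show ?case by (cases c) blast+
next
  case (Bin op s t)
  have vars: "trm_vars s \<subseteq> {..<p}" "trm_vars t \<subseteq> {..<p}" using Bin.prems(1) by auto
  obtain k1 r1 \<phi>1 where s: "encodes l p s k k1 r1 \<phi>1"
    using Bin.IH(1)[OF vars(1) Bin.prems(2)] by blast
  then have "2 * p + 6 \<le> k1" using Bin.prems(2) unfolding encodes_def by linarith
  then obtain k2 r2 \<phi>2 where t: "encodes l p t k1 k2 r2 \<phi>2"
    using Bin.IH(2)[OF vars(2)] by blast
  note complete = encodes_pair_complete[OF s t Bin.prems(2)]
  note le = encodes_pair_vars(1,2)[OF s t] and qf = encodes_pair_vars(3,4)[OF s t] and fv = encodes_pair_vars(5-8)[OF s t]
  show ?case
  proof (cases op)
    case NPlus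
    \<comment> \<open>Exponents add under multiplication, so a sum requires no new variable.\<close>
    have "encodes l p (Bin op s t) k k2 (r1 \<otimes> r2) (Conj \<phi>1 \<phi>2)"
      unfolding encodes_def
    proof (intro conjI allI impI)
      fix e :: "nat \<Rightarrow> 'a ordinal" and j assume e: "\<forall>i<p. e (p + 6 + i) = \<omega> ^ j i"
      then show "\<exists>e'. (\<forall>i. i \<notin> {k..<k2} \<longrightarrow> e' i = e i) \<and> (\<forall>i\<in>{k..<k2}. e' i \<in> domain (omega_structure l)) \<and>
          sat (omega_structure l) e' (foldr All (univ_vars p) (Conj \<phi>1 \<phi>2))"
        using complete[of e j] by metis
      assume "sat (omega_structure l) e (foldr All (univ_vars p) (Conj \<phi>1 \<phi>2))"
      then show "val (omega_structure l) e (r1 \<otimes> r2) = \<omega> ^ val nat_structure j (Bin op s t)"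
        using e encodes_sound[OF s, of e j] encodes_sound[OF t, of e j] NPlus
        by (simp add: sat_foldr_All_Conj power_add)
    qed (use le fv qf in auto)
    then show ?thesis by blast
  next
    case NTimes
    have k2: "p + 6 \<le> k2" "(trm_vars r1 \<union> trm_vars r2) \<inter> {p..<p + 6} = {}"
      "trm_vars r1 \<subseteq> {..<k2}" "trm_vars r2 \<subseteq> {..<k2}"
      using Bin.prems(2) le fv by fastforce+
    let ?\<phi> = "Conj (Conj \<phi>1 \<phi>2) (product_fm p r1 r2 k2)"
    \<comment> \<open>A product takes sixteen fresh variables, the first of which holds the
      result.\<close>
    have "encodes l p (Bin op s t) k (k2 + 16) (Var k2) ?\<phi>"
      unfolding encodes_def
    proof (intro conjI allI impI)
      fix e :: "nat \<Rightarrow> 'a ordinal" and j assume e: "\<forall>i<p. e (p + 6 + i) = \<omega> ^ j i"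
      then obtain e1 where e1: "\<And>i. i \<notin> {k..<k2} \<Longrightarrow> e1 i = e i" "\<And>i. i \<in> {k..<k2} \<Longrightarrow> e1 i \<in> domain (omega_structure l)"
        "sat (omega_structure l) e1 (foldr All (univ_vars p) (Conj \<phi>1 \<phi>2))"
        and vals: "val (omega_structure l) e1 r1 = \<omega> ^ val nat_structure j s" "val (omega_structure l) e1 r2 = \<omega> ^ val nat_structure j t"
        using complete[of e j] by metis
      obtain e2 where e2: "\<And>i. i \<notin> {k2..<k2 + 16} \<Longrightarrow> e2 i = e1 i" "\<And>i. i \<in> {k2..<k2 + 16} \<Longrightarrow> e2 i \<in> domain (omega_structure l)"
        "sat (omega_structure l) e2 (foldr All (univ_vars p) (product_fm p r1 r2 k2))"
        using product_fm_complete[OF k2(2,1) \<open>l > 1\<close> vals(1) k2(3) vals(2) k2(4)] by blast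
      have "sat (omega_structure l) e2 (foldr All (univ_vars p) (Conj \<phi>1 \<phi>2)) \<longleftrightarrow>
          sat (omega_structure l) e1 (foldr All (univ_vars p) (Conj \<phi>1 \<phi>2))"
      proof (rule sat_cong)
        fix i assume "i \<in> free_vars (foldr All (univ_vars p) (Conj \<phi>1 \<phi>2))"
        then have "i < k2" using fv unfolding free_vars_foldr_All by auto
        then show "e2 i = e1 i" using e2(1) by simp
      qed
      then have "sat (omega_structure l) e2 (foldr All (univ_vars p) ?\<phi>)"
        using e1(3) e2(3) by (simp add: sat_foldr_All_Conj)
      moreover have "\<forall>i. i \<notin> {k..<k2 + 16} \<longrightarrow> e2 i = e i" using e1(1) e2(1) le by (metis atLeastLessThan_iff le_trans trans_less_add1)
      moreover have "e2 i \<in> domain (omega_structure l)" if "i \<in> {k..<k2 + 16}" for i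
        using that e1(2)[of i] e2(1)[of i] e2(2)[of i] by (cases "i < k2") auto
      ultimately show "\<exists>e'. (\<forall>i. i \<notin> {k..<k2 + 16} \<longrightarrow> e' i = e i) \<and>
          (\<forall>i\<in>{k..<k2 + 16}. e' i \<in> domain (omega_structure l)) \<and> sat (omega_structure l) e' (foldr All (univ_vars p) ?\<phi>)"
        by blast
    next
      fix e :: "nat \<Rightarrow> 'a ordinal" and j assume e: "\<forall>i<p. e (p + 6 + i) = \<omega> ^ j i"
        and "sat (omega_structure l) e (foldr All (univ_vars p) ?\<phi>)"
      then have sat: "sat (omega_structure l) e (foldr All (univ_vars p) \<phi>1)" "sat (omega_structure l) e (foldr All (univ_vars p) \<phi>2)"
        "sat (omega_structure l) e (foldr All (univ_vars p) (product_fm p r1 r2 k2))"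
        by (simp_all add: sat_foldr_All_Conj)
      have "val (omega_structure l) e r1 = \<omega> ^ val nat_structure j s" "val (omega_structure l) e r2 = \<omega> ^ val nat_structure j t"
        using e encodes_sound[OF s _ sat(1)] encodes_sound[OF t _ sat(2)] by blast+
      then have "e k2 = \<omega> ^ (val nat_structure j s * val nat_structure j t)"
        by (rule product_fm_sound[OF k2(2,1) \<open>l > 1\<close> _ _ sat(3)])
      then show "val (omega_structure l) e (Var k2) = \<omega> ^ val nat_structure j (Bin op s t)"
        using NTimes by simp
    next
      show "free_vars ?\<phi> \<subseteq> {p..<k2 + 16}"
        using free_vars_product_fm[of p r1 r2 k2] fv k2(1) by fastforce
    qed (use le k2 qf in \<open>auto simp: quantifier_free_product_fm\<close>)
    then show ?thesis by blast
  qed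
qed

section \<open>Linking exponents to powers of \<open>\<omega> + 1\<close>, and the final
  formula\<close>

definition link_fm :: "nat \<Rightarrow> nat \<Rightarrow> omega_fm" where
  "link_fm p i = Conj (power_fm (Var (p + 6 + i)))
     (Conj (Eq (Var i \<otimes> Const C_omega_plus_one) (Const C_omega_plus_one \<otimes> Var i))
       (Eq (Var i \<otimes> Const C_omega) (Var (p + 6 + i) \<otimes> Const C_omega)))"

definition links_fm :: "nat \<Rightarrow> omega_fm" where
  "links_fm p = foldr Conj (map (link_fm p) [0..<p]) (Eq (Const C_one) (Const C_one))"

text \<open>\<open>power_omega_add_one_iff\<close> recovers \<open>(\<omega> + 1) ^ k\<close> from
  \<open>\<omega> ^ k\<close> by equations alone.\<close>

lemma sat_link_fm:
  "sat (omega_structure l) e (link_fm p i) \<longleftrightarrow> (\<exists>k. e (p + 6 + i) = \<omega> ^ k \<and> e i = (\<omega> + 1) ^ k)"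
  unfolding link_fm_def power_omega_add_one_iff by (auto simp: sat_power_fm)

lemma sat_foldr_Conj:
  "sat M e (foldr Conj \<phi>s \<psi>) \<longleftrightarrow> (\<forall>\<phi>\<in>set \<phi>s. sat M e \<phi>) \<and> sat M e \<psi>"
  by (induction \<phi>s) auto

lemma sat_links_fm:
  "sat (omega_structure l) e (links_fm p) \<longleftrightarrow> (\<forall>i<p. \<exists>k. e (p + 6 + i) = \<omega> ^ k \<and> e i = (\<omega> + 1) ^ k)"
  unfolding links_fm_def sat_foldr_Conj by (auto simp: sat_link_fm)

lemma quantifier_free_foldr_Conj:
  "quantifier_free (foldr Conj \<phi>s \<psi>) \<longleftrightarrow> (\<forall>\<phi>\<in>set \<phi>s. quantifier_free \<phi>) \<and> quantifier_free \<psi>"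
  by (induction \<phi>s) auto

lemma free_vars_foldr_Conj: "free_vars (foldr Conj \<phi>s \<psi>) = (\<Union>\<phi>\<in>set \<phi>s. free_vars \<phi>) \<union> free_vars \<psi>"
  by (induction \<phi>s) auto

lemma quantifier_free_links_fm: "quantifier_free (links_fm p)"
  by (auto simp: links_fm_def quantifier_free_foldr_Conj link_fm_def power_fm_def)

lemma free_vars_links_fm: "free_vars (links_fm p) \<subseteq> {..<p} \<union> {p + 6..<2 * p + 6}"
  by (auto simp: links_fm_def free_vars_foldr_Conj link_fm_def power_fm_def)

theorem mainTheorem10:
  fixes l :: "'a ordinal" and p :: nat and E :: "(nat_const, nat_op) fm"
  assumes "l > 1"
    and "atomic_fm E" and "free_vars E \<subseteq> {..<p}"
  shows "\<exists>m \<Phi>. exists_forall_form m 6 \<Phi> \<and>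
           defines_relation (omega_structure l) p \<Phi> (EQ_rel p E)"
proof -
  let ?M = "omega_structure l"
  obtain s t where E: "E = Eq s t" using assms(2) unfolding atomic_fm_def by blast
  \<comment> \<open>The first index after \<open>p\<close> free variables, six universal ones and
    \<open>p\<close> exponent variables.\<close>
  define k where "k = 2 * p + 6"
  obtain k1 r1 \<phi>1 where s: "encodes l p s k k1 r1 \<phi>1"
    using ex_encodes[OF assms(1), of s p k] assms(3) by (auto simp: E k_def)
  then have "k \<le> k1" unfolding encodes_def by blast
  then obtain k2 r2 \<phi>2 where t: "encodes l p t k1 k2 r2 \<phi>2"
    using ex_encodes[OF assms(1), of t p k1] assms(3) by (auto simp: E k_def)
  note le = encodes_pair_vars(1,2)[OF s t] and qf = encodes_pair_vars(3,4)[OF s t] and fv = encodes_pair_vars(5-8)[OF s t]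
  have ne: "domain ?M \<noteq> {}" using one_in_domain[OF assms(1)] by blast
  let ?\<psi> = "Conj (Eq r1 r2) (links_fm p)"
  let ?\<phi> = "Conj (Conj \<phi>1 \<phi>2) ?\<psi>"
  let ?us = "[p + 6..<k2]"
  let ?\<Phi> = "foldr Ex ?us (foldr All (univ_vars p) ?\<phi>)"
  have "exists_forall_form (length ?us) 6 ?\<Phi>"
    unfolding exists_forall_form_def
    by (intro exI[of _ ?us] exI[of _ "univ_vars p"] exI[of _ ?\<phi>])
      (use qf in \<open>auto simp: set_univ_vars quantifier_free_links_fm\<close>, simp_all add: univ_vars_def)
  moreover have "defines_relation ?M p ?\<Phi> (EQ_rel p E)"
    unfolding defines_relation_def
  proof (intro conjI)
    show "free_vars ?\<Phi> \<subseteq> {..<p}"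
      using fv free_vars_links_fm[of p] le unfolding free_vars_foldr_Ex free_vars_foldr_All set_univ_vars k_def by fastforce
    have "sat ?M e (foldr All (univ_vars p) ?\<psi>) \<longleftrightarrow> sat ?M e ?\<psi>" for e
      by (rule sat_foldr_All_vacuous[OF ne]) (use fv free_vars_links_fm[of p] in \<open>fastforce simp: set_univ_vars\<close>)
    then have sat_matrix: "sat ?M e (foldr All (univ_vars p) ?\<phi>) \<longleftrightarrow>
        sat ?M e (foldr All (univ_vars p) (Conj \<phi>1 \<phi>2)) \<and> val ?M e r1 = val ?M e r2 \<and>
        (\<forall>i<p. \<exists>k. e (p + 6 + i) = \<omega> ^ k \<and> e i = (\<omega> + 1) ^ k)" for e
      unfolding sat_foldr_All_Conj[of _ _ _ "Conj \<phi>1 \<phi>2"] by (simp add: sat_links_fm)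
    show "EQ_rel p E = {xs. length xs = p \<and> set xs \<subseteq> domain ?M \<and> sat ?M ((!) xs) ?\<Phi>}"
    proof (intro equalityI subsetI)
      fix xs :: "'a ordinal list" assume "xs \<in> EQ_rel p E"
      then obtain js where xs: "xs = map (\<lambda>j. (\<omega> + 1) ^ j) js" and js: "length js = p"
        and eq: "val nat_structure ((!) js) s = val nat_structure ((!) js) t"
        unfolding EQ_rel_def E by auto
      \<comment> \<open>On \<open>p, ..., p + 5\<close> truncated subtraction yields index 0; these
        values are harmless because the universal block rebinds those variables.\<close>
      define e where "e i = (if i < p then xs ! i else if i < k then \<omega> ^ (js ! (i - (p + 6))) else xs ! i)" for i
      have y: "e (p + 6 + i) = \<omega> ^ (js ! i)" if "i < p" for i using that by (simp add: e_def k_def)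
      obtain e' where e': "\<And>i. i \<notin> {k..<k2} \<Longrightarrow> e' i = e i" "\<And>i. i \<in> {k..<k2} \<Longrightarrow> e' i \<in> domain ?M"
        "sat ?M e' (foldr All (univ_vars p) (Conj \<phi>1 \<phi>2))"
        "val ?M e' r1 = \<omega> ^ val nat_structure ((!) js) s" "val ?M e' r2 = \<omega> ^ val nat_structure ((!) js) t"
        using encodes_pair_complete[OF s t, of e "(!) js"] y k_def by (metis order_refl)
      have "\<exists>k. e' (p + 6 + i) = \<omega> ^ k \<and> e' i = (\<omega> + 1) ^ k" if "i < p" for i
        using that y[OF that] js e'(1)[of i] e'(1)[of "p + 6 + i"] by (auto simp: k_def e_def xs)
      then have sat': "sat ?M e' (foldr All (univ_vars p) ?\<phi>)" using e'(3-5) eq unfolding sat_matrix by simp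
      \<comment> \<open>Outside the existential block the environment must be that of
        \<open>xs\<close>, so the values on the universal block are reset.\<close>
      define f where "f i = (if i \<in> set ?us then e' i else xs ! i)" for i
      have "sat ?M f (foldr All (univ_vars p) ?\<phi>) \<longleftrightarrow> sat ?M e' (foldr All (univ_vars p) ?\<phi>)"
      proof (rule sat_cong)
        fix i assume "i \<in> free_vars (foldr All (univ_vars p) ?\<phi>)"
        then have "i < p \<or> i \<in> set ?us"
          using fv free_vars_links_fm[of p] le unfolding free_vars_foldr_All set_univ_vars k_def by fastforce
        then show "f i = e' i" using e'(1)[of i] by (auto simp: f_def e_def k_def)
      qed
      moreover have "f i \<in> domain ?M" if "i \<in> set ?us" for i
        using that e'(1,2)[of i] omega_power_in_domain[OF assms(1)] by (cases "k \<le> i") (auto simp: f_def e_def)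
      ultimately have "sat ?M ((!) xs) ?\<Phi>"
        unfolding sat_foldr_Ex using sat' by (intro exI[of _ f]) (auto simp: f_def)
      moreover have "(\<omega> + 1) ^ j \<in> domain ?M" for j
        using power_omega_add_one_iff[of "(\<omega> + 1) ^ j" j] times_omega_eq_power_in_domain[OF assms(1)] by blast
      ultimately show "xs \<in> {xs. length xs = p \<and> set xs \<subseteq> domain ?M \<and> sat ?M ((!) xs) ?\<Phi>}"
        using js by (auto simp: xs)
    next
      fix xs assume "xs \<in> {xs. length xs = p \<and> set xs \<subseteq> domain ?M \<and> sat ?M ((!) xs) ?\<Phi>}"
      then obtain e where len: "length xs = p" and e: "\<And>i. i \<notin> set ?us \<Longrightarrow> e i = xs ! i"
        and sat: "sat ?M e (foldr All (univ_vars p) ?\<phi>)"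
        unfolding sat_foldr_Ex by blast
      obtain j where j: "\<And>i. i < p \<Longrightarrow> e (p + 6 + i) = \<omega> ^ j i \<and> e i = (\<omega> + 1) ^ j i"
        using sat unfolding sat_matrix by metis
      \<comment> \<open>The chosen exponents become a list of length \<open>p\<close>, as
        \<open>EQ_rel\<close> demands; the term encodings constrain only indices below
        \<open>p\<close>.\<close>
      define js where "js = map j [0..<p]"
      have y: "e (p + 6 + i) = \<omega> ^ (js ! i)" if "i < p" for i using j that by (simp add: js_def)
      \<comment> \<open>Equality of the two encoded terms transfers to the exponents since powers of
        \<open>\<omega>\<close> are distinct.\<close>
      have "\<omega> ^ val nat_structure ((!) js) s = (\<omega> ^ val nat_structure ((!) js) t :: 'a ordinal)"
        using iffD1[OF sat_matrix sat] encodes_sound[OF s, of e "(!) js"] encodes_sound[OF t, of e "(!) js"] y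
        unfolding sat_foldr_All_Conj by metis
      then have "sat nat_structure ((!) js) E" by (simp add: E omega_power_inject)
      moreover have "xs = map (\<lambda>j. (\<omega> + 1) ^ j) js"
        using len j e by (intro nth_equalityI) (auto simp: js_def)
      ultimately show "xs \<in> EQ_rel p E" unfolding EQ_rel_def js_def by force
    qed
  qed
  ultimately show ?thesis by blast
qed

end
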